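(* Let $g_1,\dots,g_m\in\mathbb{R}[x,y]$ ($m\ge1$) be nonzero, irreducible, pairwise distinct polynomials and let $Y=\{(x,y)\in\mathbb{R}^2: g_1(x,y)>0,\dots,g_m(x,y)>0\}$. Then there exists a cell decomposition $\mathcal{A}$ of $Y$ such that $(Y,\mathcal{A})$ is a CW complex and $\mathcal{A}$ has the finiteness property.
   Context: A cell decomposition of a set $X\subseteq\mathbb{R}^2$ is a partition of $X$ into (finitely or countably many) cells, each of which is a semi-algebraic set: 0-cells are points, 1-cells are subsets homeomorphic to an open interval, 2-cells are subsets homeomorphic to an open disk. A shortest-length curve in $X$ between two points $A,B\in X$ is a piecewise $C^2$ curve $\gamma$ from $A$ to $B$ lying entirely in $X$ whose length is minimal among all piecewise $C^2$ curves in $X$ from $A$ to $B$. A geodesic line segment (relative to the decomposition) is either a straight line segment or a connected arc contained (partially or entirely) in a 1-cell. A cell decomposition $\mathcal{A}$ of $X$ has the finiteness property if for every shortest-length curve $\gamma$ in $X$ between two points of $X$ and every cell $e\in\mathcal{A}$, the set $\gamma\cap e$ is either empty or has finitely many connected components, each of which is either a singleton or a geodesic line segment. *)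

theory Defs
  imports "HOL-Analysis.Analysis" "HOL-Computational_Algebra.Computational_Algebra"
begin

(* Bivariate real polynomials: R[x,y] is rendered as (R[x])[y], i.e. real poly poly:
   a polynomial in y whose coefficients are polynomials in x.  Points of R^2 are real \<times> real. *)

definition poly2 :: "real poly poly \<Rightarrow> real \<times> real \<Rightarrow> real" where
  "poly2 p z = poly (map_poly (\<lambda>c. poly c (fst z)) p) (snd z)"

inductive semialgebraic :: "(real \<times> real) set \<Rightarrow> bool" where
  sa_pos: "semialgebraic {z. poly2 p z > 0}"
| sa_zero: "semialgebraic {z. poly2 p z = 0}"
| sa_un: "semialgebraic S \<Longrightarrow> semialgebraic T \<Longrightarrow> semialgebraic (S \<union> T)"
| sa_int: "semialgebraic S \<Longrightarrow> semialgebraic T \<Longrightarrow> semialgebraic (S \<inter> T)"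
| sa_compl: "semialgebraic S \<Longrightarrow> semialgebraic (UNIV - S)"

definition cell0 :: "(real \<times> real) set \<Rightarrow> bool" where
  "cell0 e \<longleftrightarrow> (\<exists>a. e = {a})"

definition cell1 :: "(real \<times> real) set \<Rightarrow> bool" where
  "cell1 e \<longleftrightarrow> e homeomorphic {0<..<(1::real)}"

definition cell2 :: "(real \<times> real) set \<Rightarrow> bool" where
  "cell2 e \<longleftrightarrow> e homeomorphic ball (0::real \<times> real) 1"

definition cell_decomposition :: "(real \<times> real) set set \<Rightarrow> (real \<times> real) set \<Rightarrow> bool" where
  "cell_decomposition A X \<longleftrightarrow>
     countable A \<and> \<Union>A = X \<and> {} \<notin> A \<and>
     (\<forall>e\<in>A. \<forall>e'\<in>A. e \<noteq> e' \<longrightarrow> e \<inter> e' = {}) \<and>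
     (\<forall>e\<in>A. semialgebraic e \<and> (cell0 e \<or> cell1 e \<or> cell2 e))"

definition closure_in_sp :: "(real \<times> real) set \<Rightarrow> (real \<times> real) set \<Rightarrow> (real \<times> real) set" where
  "closure_in_sp X S = X \<inter> closure S"

(* (X, A) is a CW complex (X with the subspace topology of R^2, which is Hausdorff):
   characteristic maps from closed balls, boundary spheres mapped into cells of lower
   dimension, closure-finiteness, and the weak topology. *)
definition CW_complex :: "(real \<times> real) set \<Rightarrow> (real \<times> real) set set \<Rightarrow> bool" where
  "CW_complex X A \<longleftrightarrow>
     cell_decomposition A X \<and>
     (\<forall>e\<in>A. cell1 e \<longrightarrow>
        (\<exists>\<Phi> :: real \<Rightarrow> real \<times> real.
           continuous_on {-1..1} \<Phi> \<and> \<Phi> ` {-1..1} \<subseteq> X \<and>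
           (\<exists>\<psi>. homeomorphism {-1<..<1} e \<Phi> \<psi>) \<and>
           \<Phi> ` {-1, 1} \<subseteq> \<Union>{e'\<in>A. cell0 e'})) \<and>
     (\<forall>e\<in>A. cell2 e \<longrightarrow>
        (\<exists>\<Phi> :: real \<times> real \<Rightarrow> real \<times> real.
           continuous_on (cball 0 1) \<Phi> \<and> \<Phi> ` cball 0 1 \<subseteq> X \<and>
           (\<exists>\<psi>. homeomorphism (ball 0 1) e \<Phi> \<psi>) \<and>
           \<Phi> ` sphere 0 1 \<subseteq> \<Union>{e'\<in>A. cell0 e' \<or> cell1 e'})) \<and>
     (\<forall>e\<in>A. finite {e'\<in>A. e' \<inter> closure_in_sp X e \<noteq> {}}) \<and>
     (\<forall>S. S \<subseteq> X \<longrightarrow>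
        (closedin (top_of_set X) S \<longleftrightarrow>
         (\<forall>e\<in>A. closedin (top_of_set (closure_in_sp X e)) (S \<inter> closure_in_sp X e))))"

definition C2_piece :: "(real \<Rightarrow> real \<times> real) \<Rightarrow> real \<Rightarrow> real \<Rightarrow> bool" where
  "C2_piece \<gamma> a b \<longleftrightarrow>
     (\<exists>h h' h''. (\<forall>t. (h has_vector_derivative h' t) (at t)) \<and>
                 (\<forall>t. (h' has_vector_derivative h'' t) (at t)) \<and>
                 continuous_on UNIV h'' \<and>
                 (\<forall>t\<in>{a..b}. \<gamma> t = h t))"

definition piecewise_C2 :: "(real \<Rightarrow> real \<times> real) \<Rightarrow> bool" where
  "piecewise_C2 \<gamma> \<longleftrightarrow>
     (\<exists>K. finite K \<and> {0,1} \<subseteq> K \<and> K \<subseteq> {0..1} \<and>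
          (\<forall>a\<in>K. \<forall>b\<in>K. a < b \<and> {a<..<b} \<inter> K = {} \<longrightarrow> C2_piece \<gamma> a b))"

definition curve_in :: "(real \<times> real) set \<Rightarrow> real \<times> real \<Rightarrow> real \<times> real \<Rightarrow> (real \<Rightarrow> real \<times> real) \<Rightarrow> bool" where
  "curve_in X P Q \<gamma> \<longleftrightarrow> piecewise_C2 \<gamma> \<and> \<gamma> ` {0..1} \<subseteq> X \<and> \<gamma> 0 = P \<and> \<gamma> 1 = Q"

definition curve_length :: "(real \<Rightarrow> real \<times> real) \<Rightarrow> real" where
  "curve_length \<gamma> = integral {0..1} (\<lambda>t. norm (vector_derivative \<gamma> (at t)))"

definition shortest_curve :: "(real \<times> real) set \<Rightarrow> real \<times> real \<Rightarrow> real \<times> real \<Rightarrow> (real \<Rightarrow> real \<times> real) \<Rightarrow> bool" where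
  "shortest_curve X P Q \<gamma> \<longleftrightarrow>
     curve_in X P Q \<gamma> \<and> (\<forall>\<delta>. curve_in X P Q \<delta> \<longrightarrow> curve_length \<gamma> \<le> curve_length \<delta>)"

definition straight_segment :: "(real \<times> real) set \<Rightarrow> bool" where
  "straight_segment S \<longleftrightarrow> (\<exists>a b. a \<noteq> b \<and> open_segment a b \<subseteq> S \<and> S \<subseteq> closed_segment a b)"

definition geodesic_segment :: "(real \<times> real) set set \<Rightarrow> (real \<times> real) set \<Rightarrow> bool" where
  "geodesic_segment A S \<longleftrightarrow>
     straight_segment S \<or>
     (\<exists>e\<in>A. cell1 e \<and> S \<subseteq> e \<and> connected S \<and> \<not> (\<exists>p. S \<subseteq> {p}))"

definition finiteness_property :: "(real \<times> real) set \<Rightarrow> (real \<times> real) set set \<Rightarrow> bool" where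
  "finiteness_property X A \<longleftrightarrow>
     (\<forall>\<gamma> P Q. P \<in> X \<and> Q \<in> X \<and> shortest_curve X P Q \<gamma> \<longrightarrow>
        (\<forall>e\<in>A. \<gamma> ` {0..1} \<inter> e = {} \<or>
           (finite (components (\<gamma> ` {0..1} \<inter> e)) \<and>
            (\<forall>c\<in>components (\<gamma> ` {0..1} \<inter> e). (\<exists>p. c = {p}) \<or> geodesic_segment A c))))"

end

theory Submission
  imports Defs
begin

text \<open>
  Since \<open>Y\<close> is open, a shortest curve in \<open>Y\<close> admits no local shortcut, so it is traced out along the
  straight segment between its end points.  Hence every cell decomposition of \<open>Y\<close> into convex cells
  has the finiteness property: a segment meets a convex cell in a connected, convex set.

  Such a decomposition comes from a Whitney-type subdivision into dyadic squares.  One exhausts \<open>Y\<close> by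
  bounded open sets \<open>V 0, V 1, \<dots>\<close>, where \<open>V n\<close> is a union of open cells of the grid of mesh
  \<open>1 / 2 ^ n\<close> and contains the closures of the grid cells of \<open>V (n - 1)\<close>, and subdivides \<open>V n - V (n - 1)\<close>
  by the grid of mesh \<open>1 / 2 ^ n\<close>.  The closure of a cell of level \<open>n\<close> then meets only cells of level
  \<open>n\<close> and \<open>n + 1\<close>, and a finer grid only subdivides the boundary of a cell further.
\<close>

subsection \<open>Shortest curves in open sets\<close>

abbreviation speed :: "(real \<Rightarrow> real \<times> real) \<Rightarrow> real \<Rightarrow> real" where
  "speed \<gamma> t \<equiv> norm (vector_derivative \<gamma> (at t))"

lemma C2_piece_mono:
  assumes "C2_piece \<gamma> a b" "a \<le> c" "d \<le> b"
  shows "C2_piece \<gamma> c d"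
  using assms unfolding C2_piece_def by (meson atLeastAtMost_iff order_trans)

lemma C2_piece_cong:
  assumes "C2_piece \<gamma> a b" "\<And>t. t \<in> {a..b} \<Longrightarrow> \<delta> t = \<gamma> t"
  shows "C2_piece \<delta> a b"
  using assms unfolding C2_piece_def by metis

lemma C2_piece_linepath:
  assumes "\<And>t. t \<in> {a..b} \<Longrightarrow> \<gamma> t = p + (t - c) *\<^sub>R v"
  shows "C2_piece \<gamma> a b"
  unfolding C2_piece_def
proof (intro exI conjI allI ballI)
  show "((\<lambda>t. p + (t - c) *\<^sub>R v) has_vector_derivative v) (at t)" for t
    by (auto intro!: derivative_eq_intros)
  show "((\<lambda>t. v) has_vector_derivative 0) (at t)" for t
    by simp
qed (use assms in auto)

text \<open>The definition speaks only of intervals between neighbouring breakpoints. Any interval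
  free of breakpoints can be widened to the neighbouring ones \<open>a'\<close> and
  \<open>b'\<close> and the piece restricted again, so later proofs need not keep track of the end
  points \<open>0\<close> and \<open>1\<close>.\<close>

lemma piecewise_C2E:
  assumes "piecewise_C2 \<gamma>"
  obtains K where "finite K"
    "\<And>a b. 0 \<le> a \<Longrightarrow> a < b \<Longrightarrow> b \<le> 1 \<Longrightarrow> {a<..<b} \<inter> K = {} \<Longrightarrow> C2_piece \<gamma> a b"
proof -
  obtain K where K: "finite K" "{0,1} \<subseteq> K" "K \<subseteq> {0..1}"
    and piece: "\<And>a b. a \<in> K \<Longrightarrow> b \<in> K \<Longrightarrow> a < b \<Longrightarrow> {a<..<b} \<inter> K = {} \<Longrightarrow> C2_piece \<gamma> a b"
    using assms unfolding piecewise_C2_def by metis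
  have "C2_piece \<gamma> a b" if ab: "0 \<le> a" "a < b" "b \<le> 1" "{a<..<b} \<inter> K = {}" for a b
  proof -
    define a' where "a' = Max {k\<in>K. k \<le> a}"
    define b' where "b' = Min {k\<in>K. b \<le> k}"
    have "0 \<in> {k\<in>K. k \<le> a}" "1 \<in> {k\<in>K. b \<le> k}" using K ab by auto
    then have a': "a' \<in> {k\<in>K. k \<le> a}" and b': "b' \<in> {k\<in>K. b \<le> k}"
      unfolding a'_def b'_def using K(1) by (intro Max_in Min_in; auto)+
    have "k \<le> a'" if "k \<in> K" "k \<le> a" for k
      unfolding a'_def using K(1) that by (intro Max_ge) auto
    moreover have "b' \<le> k" if "k \<in> K" "b \<le> k" for k
      unfolding b'_def using K(1) that by (intro Min_le) auto
    ultimately have "{a'<..<b'} \<inter> K = {}"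
      using ab(4) by (force simp: disjoint_iff not_less)
    then have "C2_piece \<gamma> a' b'"
      using a' b' ab by (intro piece) auto
    then show ?thesis
      using a' b' by (auto intro: C2_piece_mono)
  qed
  then show ?thesis using K(1) that by blast
qed

lemma piecewise_C2I:
  assumes "finite K"
    "\<And>a b. 0 \<le> a \<Longrightarrow> a < b \<Longrightarrow> b \<le> 1 \<Longrightarrow> {a<..<b} \<inter> K = {} \<Longrightarrow> C2_piece \<gamma> a b"
  shows "piecewise_C2 \<gamma>"
  unfolding piecewise_C2_def
proof (intro exI conjI ballI impI)
  let ?K = "insert 0 (insert 1 (K \<inter> {0..1}))"
  show "finite ?K" "{0,1} \<subseteq> ?K" "?K \<subseteq> {0..1}" using assms(1) by auto
  fix a b assume "a \<in> ?K" "b \<in> ?K" "a < b \<and> {a<..<b} \<inter> ?K = {}"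
  then show "C2_piece \<gamma> a b"
    by (intro assms(2)) (auto simp: disjoint_iff)
qed

text \<open>Induction on the breakpoints: a new breakpoint \<open>k\<close> either misses
  \<open>{c<..<d}\<close> or splits it into two intervals, which \<open>glue\<close> joins. The
  hypothesis has to cover all subintervals for this induction to go through.\<close>

lemma interval_gluing_induct:
  fixes a b :: real
  assumes "finite K" "a < b"
    and "\<And>c d. a \<le> c \<Longrightarrow> c < d \<Longrightarrow> d \<le> b \<Longrightarrow> {c<..<d} \<inter> K = {} \<Longrightarrow> P c d"
    and glue: "\<And>c e d. c < e \<Longrightarrow> e < d \<Longrightarrow> P c e \<Longrightarrow> P e d \<Longrightarrow> P c d"
  shows "P a b"
  using assms(1,3)
proof (induction K rule: finite_induct)
  case empty
  then show ?case using \<open>a < b\<close> by simp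
next
  case (insert k F)
  show ?case
  proof (rule insert.IH)
    fix c d assume cd: "a \<le> c" "c < d" "d \<le> b" "{c<..<d} \<inter> F = {}"
    show "P c d"
    proof (cases "k \<in> {c<..<d}")
      case True
      have "P c k" "P k d"
        using cd True by (auto intro!: insert.prems simp: disjoint_iff)
      then show ?thesis using True glue by auto
    next
      case False
      then show ?thesis using cd by (intro insert.prems) auto
    qed
  qed
qed

lemma C2_piece_regular:
  assumes "C2_piece \<gamma> a b"
  shows "speed \<gamma> integrable_on {a..b}" "continuous_on {a..b} \<gamma>"
    "\<And>t. t \<in> {a<..<b} \<Longrightarrow> (\<gamma> has_vector_derivative vector_derivative \<gamma> (at t)) (at t)"
proof -
  obtain h h' h'' where h: "\<And>t. (h has_vector_derivative h' t) (at t)"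
    "\<And>t. (h' has_vector_derivative h'' t) (at t)" "\<And>t. t \<in> {a..b} \<Longrightarrow> \<gamma> t = h t"
    using assms unfolding C2_piece_def by metis
  have *: "(\<gamma> has_vector_derivative h' t) (at t)" if "t \<in> {a<..<b}" for t
    by (rule has_vector_derivative_transform_within_open [OF h(1) _ that]) (use h(3) in auto)
  then show "\<And>t. t \<in> {a<..<b} \<Longrightarrow> (\<gamma> has_vector_derivative vector_derivative \<gamma> (at t)) (at t)"
    using vector_derivative_at by fastforce
  have "continuous_on {a..b} h" "continuous_on {a..b} h'"
    using h(1,2) by (meson continuous_at_imp_continuous_on has_vector_derivative_continuous)+
  then show "continuous_on {a..b} \<gamma>"
    using h(3) continuous_on_eq[of "{a..b}" h \<gamma>] by simp
  have "(\<lambda>t. norm (h' t)) integrable_on {a..b}"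
    using \<open>continuous_on {a..b} h'\<close> by (intro integrable_continuous_interval continuous_intros)
  \<comment> \<open>At the end points of the piece \<open>\<gamma>\<close> may fail to be
    differentiable, so nothing is known about \<open>speed \<gamma>\<close> there; these two points
    form a null set.\<close>
  moreover have "speed \<gamma> t = norm (h' t)" if "t \<in> {a..b} - {a,b}" for t
    using vector_derivative_at[OF *, of t] that by auto
  ultimately show "speed \<gamma> integrable_on {a..b}"
    by (intro integrable_spike_finite[of "{a,b}" "{a..b}" "speed \<gamma>" "\<lambda>t. norm (h' t)"]) auto
qed

lemma piecewise_C2_regular:
  assumes "piecewise_C2 \<gamma>"
  shows "speed \<gamma> integrable_on {0..1}" "continuous_on {0..1} \<gamma>"
proof -
  obtain K where K: "finite K"
    "\<And>a b. 0 \<le> a \<Longrightarrow> a < b \<Longrightarrow> b \<le> 1 \<Longrightarrow> {a<..<b} \<inter> K = {} \<Longrightarrow> C2_piece \<gamma> a b"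
    using assms piecewise_C2E by blast
  have "speed \<gamma> integrable_on {0..1} \<and> continuous_on {0..1} \<gamma>"
  proof (rule interval_gluing_induct[OF K(1)])
    fix c e d :: real
    assume le: "c < e" "e < d"
      and 1: "speed \<gamma> integrable_on {c..e} \<and> continuous_on {c..e} \<gamma>"
      and 2: "speed \<gamma> integrable_on {e..d} \<and> continuous_on {e..d} \<gamma>"
    have "{c..d} = {c..e} \<union> {e..d}" using le by auto
    then show "speed \<gamma> integrable_on {c..d} \<and> continuous_on {c..d} \<gamma>"
      using le 1 2 Henstock_Kurzweil_Integration.integrable_combine[of c e d "speed \<gamma>"] by (auto intro!: continuous_on_closed_Un)
  qed (use K C2_piece_regular in auto)
  then show "speed \<gamma> integrable_on {0..1}" "continuous_on {0..1} \<gamma>" by auto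
qed

text \<open>The form of the fundamental theorem of calculus with finitely many exceptional points
  expresses the displacement as the integral of the velocity; its norm is at most the integral of
  the speed.\<close>

lemma dist_le_integral_speed:
  assumes "piecewise_C2 \<gamma>" "0 \<le> s" "s \<le> t" "t \<le> 1"
  shows "dist (\<gamma> s) (\<gamma> t) \<le> integral {s..t} (speed \<gamma>)"
proof -
  obtain K where K: "finite K"
    "\<And>a b. 0 \<le> a \<Longrightarrow> a < b \<Longrightarrow> b \<le> 1 \<Longrightarrow> {a<..<b} \<inter> K = {} \<Longrightarrow> C2_piece \<gamma> a b"
    using assms(1) piecewise_C2E by blast
  have sub: "{s..t} \<subseteq> {0..1}" using assms by auto
  have int: "speed \<gamma> integrable_on {s..t}" and cont: "continuous_on {s..t} \<gamma>"
    using piecewise_C2_regular[OF assms(1)] sub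
    by (auto intro: integrable_on_subinterval continuous_on_subset)
  have "(\<gamma> has_vector_derivative vector_derivative \<gamma> (at x)) (at x)" if x: "x \<in> {s<..<t} - K" for x
  proof -
    \<comment> \<open>A closed interval around \<open>x\<close> that avoids \<open>K\<close> lies in
      one smooth piece with \<open>x\<close> in its interior, so the two-sided derivative at
      \<open>x\<close> exists.\<close>
    have "open ({s<..<t} - K)" using K(1) by (intro open_Diff finite_imp_closed) auto
    then obtain e where e: "e > 0" "cball x e \<subseteq> {s<..<t} - K"
      using x open_contains_cball by blast
    have "cball x e = {x-e..x+e}" by (auto simp: dist_real_def)
    with e have sub: "{x-e..x+e} \<subseteq> {s<..<t} - K" by simp
    have "x - e \<in> {x-e..x+e}" "x + e \<in> {x-e..x+e}" using e(1) by auto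
    with sub have "x - e \<in> {s<..<t}" "x + e \<in> {s<..<t}" by blast+
    then have "C2_piece \<gamma> (x - e) (x + e)"
      using sub e(1) assms(2,4) greaterThanLessThan_subseteq_atLeastAtMost_iff[of "x - e" "x + e" "x - e" "x + e"]
      by (intro K(2)) auto
    then show ?thesis using C2_piece_regular(3) e by auto
  qed
  then have "((\<lambda>x. vector_derivative \<gamma> (at x)) has_integral (\<gamma> t - \<gamma> s)) {s..t}"
    using K(1) assms cont by (intro fundamental_theorem_of_calculus_interior_strong) auto
  then have "norm (\<gamma> t - \<gamma> s) \<le> integral {s..t} (speed \<gamma>)"
    by (metis integral_norm_bound_integral has_integral_integrable int integral_unique order_refl)
  then show ?thesis by (simp add: dist_norm norm_minus_commute)
qed

text \<open>The competitor \<open>\<delta>\<close> replaces the part of \<open>\<gamma>\<close> over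
  \<open>{s..t}\<close> by the chord. Both curves have the same length over the rest of
  \<open>{0..1}\<close>, so minimality of \<open>\<gamma>\<close> bounds its length over
  \<open>{s..t}\<close> by that of the chord.\<close>

lemma shortest_curve_shortcut:
  assumes sh: "shortest_curve X P Q \<gamma>" and st: "0 \<le> s" "s < t" "t \<le> 1"
    and seg: "closed_segment (\<gamma> s) (\<gamma> t) \<subseteq> X"
  shows "integral {s..t} (speed \<gamma>) = dist (\<gamma> s) (\<gamma> t)"
proof (rule antisym)
  have pw: "piecewise_C2 \<gamma>" and \<gamma>: "\<gamma> ` {0..1} \<subseteq> X" "\<gamma> 0 = P" "\<gamma> 1 = Q"
    and min: "\<And>\<delta>. curve_in X P Q \<delta> \<Longrightarrow> curve_length \<gamma> \<le> curve_length \<delta>"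
    using sh by (auto simp: shortest_curve_def curve_in_def)
  obtain K where K: "finite K"
    "\<And>a b. 0 \<le> a \<Longrightarrow> a < b \<Longrightarrow> b \<le> 1 \<Longrightarrow> {a<..<b} \<inter> K = {} \<Longrightarrow> C2_piece \<gamma> a b"
    using pw piecewise_C2E by blast
  show "dist (\<gamma> s) (\<gamma> t) \<le> integral {s..t} (speed \<gamma>)"
    using dist_le_integral_speed pw st by auto
  \<comment> \<open>The constant velocity that runs along the chord in the given time
    \<open>t - s\<close>, so that \<open>\<delta>\<close> joins up with \<open>\<gamma>\<close> at
    both ends.\<close>
  define v where "v = (1 / (t - s)) *\<^sub>R (\<gamma> t - \<gamma> s)"
  define \<delta> where "\<delta> r = (if r \<in> {s..t} then \<gamma> s + (r - s) *\<^sub>R v else \<gamma> r)" for r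
  have ends: "\<delta> s = \<gamma> s" "\<delta> t = \<gamma> t" using st by (auto simp: \<delta>_def v_def)
  have in_seg: "\<delta> r \<in> closed_segment (\<gamma> s) (\<gamma> t)" if "r \<in> {s..t}" for r
  proof -
    have "\<delta> r = (1 - (r - s) / (t - s)) *\<^sub>R \<gamma> s + ((r - s) / (t - s)) *\<^sub>R \<gamma> t"
      using that by (simp add: \<delta>_def v_def algebra_simps)
    moreover have "0 \<le> (r - s) / (t - s)" "(r - s) / (t - s) \<le> 1"
      using that st by auto
    ultimately show ?thesis unfolding closed_segment_def by blast
  qed
  have pw\<delta>: "piecewise_C2 \<delta>"
  \<comment> \<open>The competitor may have corners where the chord begins and ends, so
    \<open>s\<close> and \<open>t\<close> become breakpoints.\<close>
  proof (rule piecewise_C2I[of "insert s (insert t K)"])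
    fix a b :: real
    assume ab: "0 \<le> a" "a < b" "b \<le> 1" "{a<..<b} \<inter> insert s (insert t K) = {}"
    show "C2_piece \<delta> a b"
    proof (cases "s \<le> a \<and> b \<le> t")
      case True
      then show ?thesis by (intro C2_piece_linepath[of _ _ _ "\<gamma> s" s v]) (auto simp: \<delta>_def)
    next
      case False
      then have "b \<le> s \<or> t \<le> a" using ab st by (auto simp: not_le)
      then have eq: "\<delta> r = \<gamma> r" if "r \<in> {a..b}" for r
        using that ends by (cases "r = s \<or> r = t") (auto simp: \<delta>_def)
      show ?thesis
        by (rule C2_piece_cong[OF K(2) eq]) (use ab in auto)
    qed
  qed (use K in auto)
  have "\<delta> ` {0..1} \<subseteq> X"
    using \<gamma> in_seg seg by (force simp: \<delta>_def)
  moreover have "\<delta> 0 = P" "\<delta> 1 = Q"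
    using \<gamma> ends st by (auto simp: \<delta>_def)
  ultimately have le: "curve_length \<gamma> \<le> curve_length \<delta>"
    using min pw\<delta> by (simp add: curve_in_def)
  have split: "integral {0..1} (speed \<eta>) = integral {0..s} (speed \<eta>) + integral {s..t} (speed \<eta>) + integral {t..1} (speed \<eta>)"
    if "piecewise_C2 \<eta>" for \<eta>
  proof -
    have int: "speed \<eta> integrable_on {a..b}" if "0 \<le> a" "b \<le> 1" for a b
      using piecewise_C2_regular(1)[OF \<open>piecewise_C2 \<eta>\<close>] that by (auto intro: integrable_on_subinterval)
    show ?thesis
      using st Henstock_Kurzweil_Integration.integral_combine[OF _ _ int[of 0 1], of t]
        Henstock_Kurzweil_Integration.integral_combine[OF _ _ int[of 0 t], of s] by simp
  qed
  \<comment> \<open>Equal values at \<open>r\<close> alone do not give equal derivatives; the curves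
    must agree on a neighbourhood of \<open>r\<close>. This leaves out \<open>s\<close> and
    \<open>t\<close>, which the integrals below ignore.\<close>
  have off: "speed \<delta> r = speed \<gamma> r" if "r \<in> U" "open U" "U \<inter> {s..t} = {}" for r U
  proof -
    have "\<forall>\<^sub>F x in nhds r. \<delta> x = \<gamma> x"
      unfolding eventually_nhds using that by (intro exI[of _ U]) (auto simp: \<delta>_def)
    then show ?thesis
      by (simp add: vector_derivative_cong_eq)
  qed
  have "integral {0..s} (speed \<delta>) = integral {0..s} (speed \<gamma>)"
    by (rule integral_spike[of "{s}"]) (use st in \<open>auto intro!: off[of _ "{..<s}", symmetric]\<close>)
  moreover have "integral {t..1} (speed \<delta>) = integral {t..1} (speed \<gamma>)"
    by (rule integral_spike[of "{t}"]) (use st in \<open>auto intro!: off[of _ "{t<..}", symmetric]\<close>)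
  moreover have "integral {s..t} (speed \<delta>) = dist (\<gamma> s) (\<gamma> t)"
  proof -
    have "speed \<delta> r = norm v" if "r \<in> {s<..<t}" for r
    proof -
      have "((\<lambda>r. \<gamma> s + (r - s) *\<^sub>R v) has_vector_derivative v) (at r)"
        by (auto intro!: derivative_eq_intros)
      then have "(\<delta> has_vector_derivative v) (at r)"
        by (rule has_vector_derivative_transform_within_open[OF _ _ that]) (auto simp: \<delta>_def)
      then show ?thesis by (simp add: vector_derivative_at)
    qed
    then have "integral {s..t} (speed \<delta>) = integral {s..t} (\<lambda>_. norm v)"
      by (intro integral_spike[of "{s,t}"]) auto
    also have "\<dots> = dist (\<gamma> s) (\<gamma> t)"
      using st by (simp add: v_def dist_norm norm_minus_commute)
    finally show ?thesis .
  qed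
  ultimately show "integral {s..t} (speed \<gamma>) \<le> dist (\<gamma> s) (\<gamma> t)"
    using le split[OF pw] split[OF pw\<delta>] by (simp add: curve_length_def)
qed

text \<open>Equality in the triangle inequality puts both \<open>x - p\<close> and
  \<open>z - y\<close> on the ray spanned by \<open>y - x\<close>, and along one ray lengths add.
  The nondegenerate overlap from \<open>x\<close> to \<open>y\<close> is what forces the two
  directions to agree.\<close>

lemma dist_add_chain:
  fixes p x y z :: "'a::real_inner"
  assumes "dist p y = dist p x + dist x y" "dist x z = dist x y + dist y z" "x \<noteq> y"
  shows "dist p z = dist p y + dist y z"
proof -
  let ?v = "y - x"
  have n: "norm ?v > 0" using assms(3) by simp
  have "norm (x - p + ?v) = norm (x - p) + norm ?v" "norm (?v + (z - y)) = norm ?v + norm (z - y)"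
    using assms by (simp_all add: dist_norm norm_minus_commute)
  then have "norm (x - p) *\<^sub>R ?v = norm ?v *\<^sub>R (x - p)" "norm ?v *\<^sub>R (z - y) = norm (z - y) *\<^sub>R ?v"
    by (simp_all only: norm_triangle_eq)
  then obtain a b where ab: "a \<ge> 0" "b \<ge> 0" "x - p = a *\<^sub>R ?v" "z - y = b *\<^sub>R ?v"
    using n by (intro that[of "norm (x - p) / norm ?v" "norm (z - y) / norm ?v"])
      (auto simp: eq_vector_fraction_iff)
  have "y - p = (a + 1) *\<^sub>R ?v"
    using ab(3) by (simp add: algebra_simps)
  moreover have "z - p = (a + 1 + b) *\<^sub>R ?v"
  proof -
    have "z - p = (x - p) + ?v + (z - y)" by simp
    then show ?thesis unfolding ab(3,4) by (simp only: scaleR_add_left scaleR_one)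
  qed
  ultimately show ?thesis
    using ab(1,2,4) by (simp add: dist_norm norm_minus_commute[of p] norm_minus_commute[of y z] flip: distrib_right)
qed

text \<open>
  The steps of length below \<open>\<delta>\<close> are measured in \<open>l\<close> (arc length) and not in the parameter: a curve that
  rests at a point for a while could change its direction there.
\<close>

lemma locally_isometric_imp_isometric:
  fixes c :: "real \<Rightarrow> 'a::real_inner" and l :: "real \<Rightarrow> real"
  assumes cont: "continuous_on {0..1} l" and mono: "mono_on {0..1} l" and "l 0 = 0" and "\<delta> > 0"
    and loc: "\<And>s t. 0 \<le> s \<Longrightarrow> s \<le> t \<Longrightarrow> t \<le> 1 \<Longrightarrow> l t - l s < \<delta> \<Longrightarrow> dist (c s) (c t) = l t - l s"
    and t: "t \<in> {0..1}"
  shows "dist (c 0) (c t) = l t"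
proof -
  \<comment> \<open>The induction advances by arc length \<open>d\<close>, while the overlapping
    chords have length up to \<open>2 * d\<close>, which must stay below
    \<open>\<delta>\<close>.\<close>
  define d where "d = \<delta> / 3"
  have d: "d > 0" "2 * d < \<delta>" using \<open>\<delta> > 0\<close> by (auto simp: d_def)
  have "\<forall>t\<in>{0..1}. l t \<le> real k * d \<longrightarrow> dist (c 0) (c t) = l t" for k
  proof (induction k)
    case 0
    then show ?case
      using loc[of 0] \<open>l 0 = 0\<close> \<open>\<delta> > 0\<close> by auto
  next
    case (Suc k)
    show ?case
    proof (intro ballI impI)
      fix t :: real assume t: "t \<in> {0..1}" and lt: "l t \<le> real (Suc k) * d"
      show "dist (c 0) (c t) = l t"
      proof (cases "l t < \<delta>")
        case True
        then show ?thesis using loc[of 0 t] t \<open>l 0 = 0\<close> by auto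
      next
        case False
        \<comment> \<open>Parameters \<open>y\<close> and \<open>x\<close> are chosen at arc length
          \<open>d\<close> and \<open>2 * d\<close> before \<open>t\<close>; both values are
          nonnegative because \<open>l t\<close> is at least \<open>\<delta>\<close>. The induction
          hypothesis reaches \<open>x\<close> and \<open>y\<close>, and the stretch from
          \<open>x\<close> to \<open>t\<close> is short enough for \<open>loc\<close>.\<close>
        have ivt: "\<exists>x\<ge>0. x \<le> t \<and> l x = y" if "0 \<le> y" "y \<le> l t" for y
          using that t \<open>l 0 = 0\<close> cont by (intro IVT') (auto intro: continuous_on_subset)
        obtain y where y: "0 \<le> y" "y \<le> t" "l y = l t - d" using ivt[of "l t - d"] False d by auto
        obtain x where x: "0 \<le> x" "x \<le> t" "l x = l t - 2 * d" using ivt[of "l t - 2 * d"] False d by auto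
        have xy: "x \<le> y"
          using mono t x y d by (force simp: mono_on_def dest: spec[of _ y])
        have "dist (c 0) (c y) = l y" "dist (c 0) (c x) = l x"
          using Suc.IH lt x y t d by (auto simp: algebra_simps)
        moreover have "dist (c x) (c y) = l y - l x" "dist (c y) (c t) = l t - l y" "dist (c x) (c t) = l t - l x"
          using loc x y xy t d by auto
        ultimately show ?thesis
          using dist_add_chain[of "c 0" "c y" "c x" "c t"] x y d by force
      qed
    qed
  qed
  moreover obtain k where "l t \<le> real k * d"
    using d by (meson ex_less_of_nat_mult less_imp_le)
  ultimately show ?thesis using t by auto
qed

text \<open>Short chords stay inside \<open>X\<close>, so by the shortcut lemma
  \<open>\<gamma>\<close> is isometric to its arc length locally and hence globally. Its length is
  then \<open>dist P Q\<close>, which places each of its points between \<open>P\<close> and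
  \<open>Q\<close>. Only the image is determined: the parametrization may pause.\<close>

lemma shortest_curve_in_open:
  assumes "open X" and sh: "shortest_curve X P Q \<gamma>"
  shows "\<gamma> ` {0..1} = closed_segment P Q"
proof -
  have pw: "piecewise_C2 \<gamma>" and \<gamma>: "\<gamma> ` {0..1} \<subseteq> X" "\<gamma> 0 = P" "\<gamma> 1 = Q"
    using sh by (auto simp: shortest_curve_def curve_in_def)
  note int = piecewise_C2_regular(1)[OF pw] and cont = piecewise_C2_regular(2)[OF pw]
  define l where "l t = integral {0..t} (speed \<gamma>)" for t
  have ldiff: "integral {s..t} (speed \<gamma>) = l t - l s" if "0 \<le> s" "s \<le> t" "t \<le> 1" for s t
  proof -
    have "speed \<gamma> integrable_on {0..t}" using int that by (auto intro: integrable_on_subinterval)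
    then show ?thesis
      using Henstock_Kurzweil_Integration.integral_combine[OF that(1,2), of "speed \<gamma>"] unfolding l_def by fastforce
  qed
  have dist_le: "dist (\<gamma> s) (\<gamma> t) \<le> l t - l s" if "0 \<le> s" "s \<le> t" "t \<le> 1" for s t
    using dist_le_integral_speed[OF pw that] ldiff[OF that] by simp
  \<comment> \<open>Compactness of the image gives one radius that works along the whole
    curve.\<close>
  obtain \<delta> where \<delta>: "\<delta> > 0" "\<And>x. x \<in> \<gamma> ` {0..1} \<Longrightarrow> ball x \<delta> \<subseteq> X"
    using compact_subset_open_imp_ball_epsilon_subset[OF compact_continuous_image[OF cont] \<open>open X\<close> \<gamma>(1)]
    by (metis UN_subset_iff compact_Icc)
  have "dist (\<gamma> 0) (\<gamma> 1) = l 1"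
  proof (rule locally_isometric_imp_isometric[where \<delta> = \<delta>])
    show "continuous_on {0..1} l"
      unfolding l_def using int by (rule indefinite_integral_continuous_1)
    show "mono_on {0..1} l"
    proof (rule mono_onI)
      fix r s :: real assume "r \<in> {0..1}" "s \<in> {0..1}" "r \<le> s"
      then have "dist (\<gamma> r) (\<gamma> s) \<le> l s - l r" by (intro dist_le) auto
      then show "l r \<le> l s" using zero_le_dist[of "\<gamma> r" "\<gamma> s"] by linarith
    qed
    fix s t :: real assume st: "0 \<le> s" "s \<le> t" "t \<le> 1" "l t - l s < \<delta>"
    show "dist (\<gamma> s) (\<gamma> t) = l t - l s"
    proof (cases "s = t")
      case False
      have "\<gamma> t \<in> ball (\<gamma> s) \<delta>" using dist_le[OF st(1-3)] st by auto
      then have "closed_segment (\<gamma> s) (\<gamma> t) \<subseteq> ball (\<gamma> s) \<delta>"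
        using \<delta>(1) by (intro closed_segment_subset) auto
      then have "closed_segment (\<gamma> s) (\<gamma> t) \<subseteq> X" using \<delta>(2)[of "\<gamma> s"] st by auto
      then show ?thesis
        using shortest_curve_shortcut[OF sh _ _ _] st False ldiff by force
    qed auto
  qed (use \<delta> in \<open>auto simp: l_def\<close>)
  then have len: "dist P Q = l 1" using \<gamma> by simp
  have in_seg: "\<gamma> r \<in> closed_segment P Q" if "r \<in> {0..1}" for r
  proof -
    have "dist P (\<gamma> r) + dist (\<gamma> r) Q \<le> dist P Q"
      using dist_le[of 0 r] dist_le[of r 1] that len \<gamma> by (auto simp: l_def)
    then have "between (P, Q) (\<gamma> r)"
      by (simp add: between antisym dist_triangle)
    then show ?thesis by (simp add: between_mem_segment)
  qed
  moreover have "x \<in> \<gamma> ` {0..1}" if x: "x \<in> closed_segment P Q" for x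
  proof -
    have "dist P x \<le> dist P Q"
      using x by (metis between between_mem_segment le_add_same_cancel1 zero_le_dist)
    \<comment> \<open>The curve covers the segment: the distance from \<open>P\<close> takes every
      value up to \<open>dist P Q\<close>, and a point of the segment is determined by that
      distance.\<close>
    moreover have "continuous_on {0..1} (\<lambda>r. dist P (\<gamma> r))"
      using cont by (intro continuous_intros)
    ultimately obtain r where r: "r \<in> {0..1}" "dist P (\<gamma> r) = dist P x"
      using IVT'[of "\<lambda>r. dist P (\<gamma> r)" 0 "dist P x" 1] \<gamma> by auto
    obtain u where u: "0 \<le> u" "x = P + u *\<^sub>R (Q - P)"
      using x by (auto simp: closed_segment_def algebra_simps)
    obtain w where w: "0 \<le> w" "\<gamma> r = P + w *\<^sub>R (Q - P)"
      using in_seg[OF r(1)] by (auto simp: closed_segment_def algebra_simps)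
    have "w * norm (Q - P) = u * norm (Q - P)"
      using r(2) u w by (simp add: dist_norm)
    then have "\<gamma> r = x" using u w by auto
    then show ?thesis using r by auto
  qed
  ultimately show ?thesis by blast
qed

text \<open>The closure of \<open>S\<close> is compact, convex and collinear, hence a segment. A
  convex set has the same relative interior as its closure, so \<open>S\<close> contains the open
  segment and can only miss end points.\<close>

lemma convex_subset_segment:
  fixes S :: "(real \<times> real) set"
  assumes "convex S" "S \<noteq> {}" "S \<subseteq> closed_segment p q"
  shows "(\<exists>a. S = {a}) \<or> straight_segment S"
proof -
  have cl: "closure S \<subseteq> closed_segment p q"
    using assms(3) by (simp add: closure_minimal)
  have "compact (closure S)"
    using assms(3) by (meson bounded_closed_segment bounded_subset compact_closure)
  moreover have "collinear (closure S)"
    using cl collinear_closed_segment collinear_subset by blast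
  ultimately obtain a b where ab: "closure S = closed_segment a b"
    using compact_convex_collinear_segment[of "closure S"] assms by (metis closure_eq_empty convex_closure)
  show ?thesis
  proof (cases "a = b")
    case True
    then have "S \<subseteq> {a}" using ab closure_subset[of S] by simp
    then show ?thesis using assms(2) by blast
  next
    case False
    have "open_segment a b = rel_interior S"
      using convex_rel_interior_closure[OF assms(1)] ab False by (simp add: rel_interior_closed_segment)
    then show ?thesis
      unfolding straight_segment_def using False ab rel_interior_subset closure_subset by blast
  qed
qed

section \<open>The finiteness property for convex cells\<close>

lemma convex_cells_finiteness_property:
  assumes "open X" "\<And>e. e \<in> A \<Longrightarrow> convex e"
  shows "finiteness_property X A"
  unfolding finiteness_property_def
proof (intro allI impI ballI, elim conjE)
  fix \<gamma> P Q e
  assume sh: "shortest_curve X P Q \<gamma>" and e: "e \<in> A"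
  define S where "S = \<gamma> ` {0..1} \<inter> e"
  have S: "convex S" "S \<subseteq> closed_segment P Q"
    using shortest_curve_in_open[OF assms(1) sh] assms(2)[OF e] by (auto simp: S_def intro: convex_Int)
  have "finite (components S) \<and> (\<forall>c\<in>components S. (\<exists>p. c = {p}) \<or> geodesic_segment A c)" if "S \<noteq> {}"
  proof -
    have "components S = {S}"
      using S that convex_connected components_eq_sing_iff by blast
    then show ?thesis
      using convex_subset_segment[OF S(1) that S(2)] by (auto simp: geodesic_segment_def)
  qed
  then show "\<gamma> ` {0..1} \<inter> e = {} \<or> finite (components (\<gamma> ` {0..1} \<inter> e)) \<and>
    (\<forall>c\<in>components (\<gamma> ` {0..1} \<inter> e). (\<exists>p. c = {p}) \<or> geodesic_segment A c)"
    unfolding S_def by blast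
qed

subsection \<open>Characteristic maps and semialgebraic sets\<close>

lemma poly2_pCons: "poly2 (pCons c p) z = poly c (fst z) + snd z * poly2 p z"
  by (simp add: poly2_def map_poly_pCons)

lemma poly2_0 [simp]: "poly2 0 z = 0"
  by (simp add: poly2_def)

lemma continuous_on_poly2: "continuous_on UNIV (poly2 p)"
proof (induction p)
  case 0
  then show ?case by (simp add: poly2_def)
next
  case (pCons c p)
  then show ?case by (simp add: poly2_pCons cong: continuous_on_cong) (intro continuous_intros)
qed

lemma semialgebraic_poly2_less: "semialgebraic {z. poly2 p z < 0}"
proof -
  have "{z. poly2 p z < 0} = (UNIV - {z. poly2 p z > 0}) \<inter> (UNIV - {z. poly2 p z = 0})"
    by auto
  then show ?thesis
    by (metis sa_compl sa_int sa_pos sa_zero)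
qed

lemma semialgebraic_halfplanes:
  "semialgebraic {z. fst z = a}" "semialgebraic {z. fst z > a}" "semialgebraic {z. fst z < a}"
  "semialgebraic {z. snd z = a}" "semialgebraic {z. snd z > a}" "semialgebraic {z. snd z < a}"
proof -
  \<comment> \<open>The outer variable is the second coordinate, so \<open>[:[:-a, 1:]:]\<close> is
    constant in it and represents x - a, while \<open>[:[:-a:], 1:]\<close> represents y -
    a.\<close>
  have 1: "poly2 [:[:-a, 1:]:] z = fst z - a" "poly2 [:[:-a:], 1:] z = snd z - a" for z
    by (simp_all add: poly2_pCons)
  show "semialgebraic {z. fst z = a}" "semialgebraic {z. fst z > a}" "semialgebraic {z. fst z < a}"
    using sa_zero[of "[:[:-a, 1:]:]"] sa_pos[of "[:[:-a, 1:]:]"] semialgebraic_poly2_less[of "[:[:-a, 1:]:]"]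
    unfolding 1 by simp_all
  show "semialgebraic {z. snd z = a}" "semialgebraic {z. snd z > a}" "semialgebraic {z. snd z < a}"
    using sa_zero[of "[:[:-a:], 1:]"] sa_pos[of "[:[:-a:], 1:]"] semialgebraic_poly2_less[of "[:[:-a:], 1:]"]
    unfolding 1 by simp_all
qed

section \<open>Characteristic maps of segments and convex bodies\<close>

lemma segment_characteristic_map:
  fixes p q :: "'a::real_normed_vector"
  assumes "p \<noteq> q"
  obtains f :: "real \<Rightarrow> 'a" and g where "continuous_on {-1..1} f" "f ` {-1..1} = closed_segment p q"
    "homeomorphism {-1<..<1} (open_segment p q) f g" "f ` {-1, 1} = {p, q}"
proof -
  define f where "f t = (1 - (1 + t) / 2) *\<^sub>R p + ((1 + t) / 2) *\<^sub>R q" for t :: real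
  have cont: "continuous_on {-1..1} f" unfolding f_def by (intro continuous_intros ballI) simp_all
  \<comment> \<open>Factoring \<open>f\<close> through the unit interval reduces both image
    computations to the descriptions of segments as images of \<open>{0..1}\<close> and
    \<open>{0<..<1}\<close>.\<close>
  have re: "f ` S = (\<lambda>u. (1 - u) *\<^sub>R p + u *\<^sub>R q) ` ((\<lambda>t. (1 + t) / 2) ` S)" for S
    by (auto simp: f_def image_image)
  have "(\<lambda>t. (1 + t) / 2) ` {-1..1} = {0..1::real}"
    by (auto simp: image_iff intro!: bexI[of _ "2 * _ - 1"])
  then have closed: "f ` {-1..1} = closed_segment p q"
    by (simp only: re closed_segment_image_interval)
  have "(\<lambda>t. (1 + t) / 2) ` {-1<..<1} = {0<..<1::real}"
    by (auto simp: image_iff intro!: bexI[of _ "2 * _ - 1"])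
  then have op: "f ` {-1<..<1} = open_segment p q"
    using assms by (simp only: re open_segment_image_interval if_False)
  have "inj_on f {-1..1}"
  proof (rule inj_onI)
    fix s t assume "f s = f t"
    then have "((s - t) / 2) *\<^sub>R (q - p) = 0"
      by (simp add: f_def algebra_simps diff_divide_distrib add_divide_distrib)
    then show "s = t" using assms by simp
  qed
  then obtain g where "homeomorphism {-1..1} (closed_segment p q) f g"
    using homeomorphism_compact[OF _ cont closed] by auto
  then have "homeomorphism {-1<..<1} (open_segment p q) f g"
    by (rule homeomorphism_of_subsets) (use op in auto)
  moreover have "f ` {-1, 1} = {p, q}" by (simp add: f_def)
  ultimately show ?thesis using cont closed that by blast
qed

text \<open>A convex body is homeomorphic to the closed ball. Invariance of domain, applied to the
  map and to its inverse, shows that interiors correspond, and therefore the sphere goes onto the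
  boundary.\<close>

lemma convex_body_characteristic_map:
  fixes S :: "'a::euclidean_space set"
  assumes "convex S" "compact S" "interior S \<noteq> {}"
  obtains f :: "'a \<Rightarrow> 'a" and g where "homeomorphism (cball 0 1) S f g"
    "homeomorphism (ball 0 1) (interior S) f g" "f ` sphere 0 1 = S - interior S"
proof -
  have "S homeomorphic cball (0::'a) 1"
    using assms by (intro homeomorphic_convex_compact_cball) auto
  then obtain f g where fg: "homeomorphism (cball (0::'a) 1) S f g"
    using homeomorphic_def homeomorphic_sym by blast
  have inj: "inj_on f (cball 0 1)" "inj_on g S"
    using fg by (metis homeomorphism_def inj_on_inverseI)+
  have f: "continuous_on (cball 0 1) f" "f ` cball 0 1 = S" and g: "continuous_on S g" "g ` S = cball 0 1"
    using fg by (auto simp: homeomorphism_def)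
  have "open (f ` ball 0 1)"
    using f(1) inj(1) ball_subset_cball
    by (metis invariance_of_domain open_ball continuous_on_subset inj_on_subset)
  then have 1: "f ` ball 0 1 \<subseteq> interior S"
    using f(2) ball_subset_cball by (intro interior_maximal) auto
  have "open (g ` interior S)"
    using g(1) inj(2) interior_subset
    by (metis invariance_of_domain open_interior continuous_on_subset inj_on_subset)
  then have "g ` interior S \<subseteq> interior (cball 0 1)"
    using g(2) interior_subset by (intro interior_maximal) auto
  then have "g ` interior S \<subseteq> ball 0 1" by simp
  then have 2: "interior S \<subseteq> f ` ball 0 1"
    using fg interior_subset by (force simp: homeomorphism_def image_iff)
  have eq: "f ` ball 0 1 = interior S" using 1 2 by blast
  have "homeomorphism (ball 0 1) (interior S) f g"
    by (rule homeomorphism_of_subsets[OF fg _ _ eq]) auto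
  moreover have "f ` sphere 0 1 = S - interior S"
  proof -
    have "sphere (0::'a) 1 = cball 0 1 - ball 0 1" by auto
    then show ?thesis
      using inj_on_image_set_diff[OF inj(1), of "cball 0 1" "ball 0 1"] f(2) eq by auto
  qed
  ultimately show ?thesis using fg that by blast
qed

text \<open>\<open>CW_complex\<close> asks for characteristic maps according to the topological type
  of a cell, so this type must determine whether a grid cell is a vertex, an edge or a square.
  Finiteness separates points from the rest, and invariance of dimension separates intervals from
  disks.\<close>

lemma cell_dimension_unique:
  "cell0 e \<Longrightarrow> \<not> cell1 e" "cell0 e \<Longrightarrow> \<not> cell2 e" "cell1 e \<Longrightarrow> \<not> cell2 e"
proof -
  have fin: "\<not> finite {0<..<1::real}" "\<not> finite (ball (0::real \<times> real) 1)"
    using uncountable_ball[of 1 "0 :: real \<times> real"] countable_finite by (auto simp: infinite_Ioo)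
  show "cell0 e \<Longrightarrow> \<not> cell1 e" "cell0 e \<Longrightarrow> \<not> cell2 e"
    using fin unfolding cell0_def cell1_def cell2_def
    by (metis finite.emptyI finite_insert homeomorphic_finite homeomorphic_sym)+
  show "\<not> cell2 e" if "cell1 e"
  proof
    assume "cell2 e"
    then have "ball (0::real \<times> real) 1 homeomorphic {0<..<1::real}"
      using \<open>cell1 e\<close> unfolding cell1_def cell2_def by (meson homeomorphic_sym homeomorphic_trans)
    then obtain f g where fg: "homeomorphism (ball (0::real \<times> real) 1) {0<..<1::real} f g"
      by (auto simp: homeomorphic_def)
    have "DIM(real \<times> real) \<le> DIM(real)"
    proof (rule invariance_of_dimension)
      show "continuous_on (ball 0 1) f" "inj_on f (ball 0 1)"
        using fg by (auto simp: homeomorphism_def intro: inj_on_inverseI)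
    qed auto
    then show False by simp
  qed
qed

subsection \<open>Dyadic grid cells\<close>

definition dyadic_floor :: "nat \<Rightarrow> real \<Rightarrow> real" where
  "dyadic_floor n x = of_int \<lfloor>2 ^ n * x\<rfloor> / 2 ^ n"

definition dyadic_ceiling :: "nat \<Rightarrow> real \<Rightarrow> real" where
  "dyadic_ceiling n x = of_int \<lceil>2 ^ n * x\<rceil> / 2 ^ n"

text \<open>Fixing floor and ceiling together yields the partition of the line into grid points and
  open intervals between neighbouring grid points: floor and ceiling agree exactly at the grid
  points.\<close>

definition dyadic_cell :: "nat \<Rightarrow> real \<Rightarrow> real set" where
  "dyadic_cell n x = {t. \<lfloor>2 ^ n * t\<rfloor> = \<lfloor>2 ^ n * x\<rfloor> \<and> \<lceil>2 ^ n * t\<rceil> = \<lceil>2 ^ n * x\<rceil>}"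

lemma dyadic_floor_le: "dyadic_floor n x \<le> x"
  and dyadic_ceiling_ge: "x \<le> dyadic_ceiling n x"
  and less_dyadic_floor: "x < dyadic_floor n x + 1 / 2 ^ n"
  and dyadic_ceiling_less: "dyadic_ceiling n x - 1 / 2 ^ n < x"
proof -
  have "of_int \<lfloor>2 ^ n * x\<rfloor> \<le> 2 ^ n * x" "2 ^ n * x \<le> of_int \<lceil>2 ^ n * x\<rceil>"
    "2 ^ n * x < of_int \<lfloor>2 ^ n * x\<rfloor> + 1" "of_int \<lceil>2 ^ n * x\<rceil> - 1 < 2 ^ n * x"
    by linarith+
  then show "dyadic_floor n x \<le> x" "x \<le> dyadic_ceiling n x"
    "x < dyadic_floor n x + 1 / 2 ^ n" "dyadic_ceiling n x - 1 / 2 ^ n < x"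
    unfolding dyadic_floor_def dyadic_ceiling_def by (simp_all add: field_simps)
qed

lemma dyadic_ceiling_le_floor: "dyadic_ceiling n x \<le> dyadic_floor n x + 1 / 2 ^ n"
proof -
  have "\<lceil>2 ^ n * x\<rceil> \<le> \<lfloor>2 ^ n * x\<rfloor> + 1" by linarith
  then have "real_of_int \<lceil>2 ^ n * x\<rceil> \<le> of_int \<lfloor>2 ^ n * x\<rfloor> + 1" by linarith
  then show ?thesis
    unfolding dyadic_floor_def dyadic_ceiling_def by (simp add: field_simps)
qed

text \<open>This and the next lemma are semicontinuity statements with explicit neighbourhoods:
  close to \<open>x\<close> the ceiling can only go up and the floor can only go down. They make the
  stars below shrink locally.\<close>

lemma dyadic_ceiling_mono_near:
  assumes "dyadic_ceiling n x - 1 / 2 ^ n < w"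
  shows "dyadic_ceiling n x \<le> dyadic_ceiling n w"
proof -
  have "of_int \<lceil>2 ^ n * x\<rceil> - 1 < 2 ^ n * w"
    using assms unfolding dyadic_ceiling_def by (simp add: field_simps)
  then have "\<lceil>2 ^ n * x\<rceil> \<le> \<lceil>2 ^ n * w\<rceil>" by linarith
  then show ?thesis
    unfolding dyadic_ceiling_def by (simp add: divide_right_mono)
qed

lemma dyadic_floor_mono_near:
  assumes "w < dyadic_floor n x + 1 / 2 ^ n"
  shows "dyadic_floor n w \<le> dyadic_floor n x"
proof -
  have "2 ^ n * w < of_int \<lfloor>2 ^ n * x\<rfloor> + 1"
    using assms unfolding dyadic_floor_def by (simp add: field_simps)
  then have "\<lfloor>2 ^ n * w\<rfloor> \<le> \<lfloor>2 ^ n * x\<rfloor>" by linarith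
  then show ?thesis
    unfolding dyadic_floor_def by (simp add: divide_right_mono)
qed

lemma dyadic_endpoints_Ints: "2 ^ n * dyadic_floor n x \<in> \<int>" "2 ^ n * dyadic_ceiling n x \<in> \<int>"
  by (simp_all add: dyadic_floor_def dyadic_ceiling_def)

lemma dyadic_Ints_mono:
  assumes "2 ^ m * x \<in> \<int>" "m \<le> n"
  shows "2 ^ n * (x::real) \<in> \<int>"
proof -
  have "2 ^ n * x = 2 ^ (n - m) * (2 ^ m * x)"
    using assms(2) by (simp flip: power_add mult.assoc)
  then show ?thesis using assms(1) by (metis Ints_mult Ints_numeral Ints_power)
qed

lemma dyadic_cell_self: "x \<in> dyadic_cell n x"
  by (simp add: dyadic_cell_def)

lemma dyadic_cell_eq: "y \<in> dyadic_cell n x \<Longrightarrow> dyadic_cell n y = dyadic_cell n x"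
  by (auto simp: dyadic_cell_def)

lemma dyadic_cell_floor_ceiling:
  assumes "y \<in> dyadic_cell n x"
  shows "dyadic_floor n y = dyadic_floor n x" "dyadic_ceiling n y = dyadic_ceiling n x"
  using assms by (auto simp: dyadic_cell_def dyadic_floor_def dyadic_ceiling_def)

text \<open>The coarse floor is an integer quotient of the fine one, and the same follows for
  ceilings by negation; hence the fine pair determines the coarse pair.\<close>

lemma dyadic_cell_coarsen:
  assumes "y \<in> dyadic_cell n x" "m \<le> n"
  shows "y \<in> dyadic_cell m x"
proof -
  have scale: "2 ^ m * t = (2 ^ n * t) / real_of_int (2 ^ (n - m))" for t :: real
  proof -
    have "(2::real) ^ n = 2 ^ m * 2 ^ (n - m)" using assms(2) by (simp flip: power_add)
    then show ?thesis by simp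
  qed
  have fl: "\<lfloor>2 ^ m * t\<rfloor> = \<lfloor>2 ^ n * t\<rfloor> div 2 ^ (n - m)" for t :: real
    unfolding scale by (rule floor_divide_real_eq_div) simp
  have ce: "\<lceil>2 ^ m * t\<rceil> = - (- \<lceil>2 ^ n * t\<rceil> div 2 ^ (n - m))" for t :: real
    using fl[of "- t"] by (simp add: ceiling_def)
  show ?thesis
    using assms(1) by (simp add: dyadic_cell_def fl ce)
qed

lemma dyadic_cell_Ints:
  assumes "2 ^ n * x \<in> \<int>"
  shows "dyadic_cell n x = {x}"
proof -
  obtain k where k: "2 ^ n * x = of_int k" using assms by (elim Ints_cases)
  have "t = x" if "t \<in> dyadic_cell n x" for t
  proof -
    have "\<lfloor>2 ^ n * t\<rfloor> = k" "\<lceil>2 ^ n * t\<rceil> = k" using that k by (auto simp: dyadic_cell_def)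
    then have "2 ^ n * t = of_int k" by linarith
    then have "2 ^ n * t = 2 ^ n * x" using k by simp
    then show ?thesis by simp
  qed
  then show ?thesis using dyadic_cell_self by blast
qed

lemma dyadic_cell_not_Ints:
  assumes "2 ^ n * x \<notin> \<int>"
  shows "dyadic_cell n x = {dyadic_floor n x<..<dyadic_ceiling n x}" "dyadic_floor n x < dyadic_ceiling n x"
proof -
  define m where "m = \<lfloor>2 ^ n * x\<rfloor>"
  have "2 ^ n * x \<noteq> of_int m" using assms by auto
  then have c: "\<lceil>2 ^ n * x\<rceil> = m + 1"
    by (simp add: ceiling_altdef m_def)
  have "t \<in> dyadic_cell n x \<longleftrightarrow> of_int m < 2 ^ n * t \<and> 2 ^ n * t < of_int (m + 1)" for t
    unfolding dyadic_cell_def c m_def[symmetric] by (auto; linarith)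
  also have "\<dots> t \<longleftrightarrow> t \<in> {dyadic_floor n x<..<dyadic_ceiling n x}" for t
    unfolding dyadic_floor_def dyadic_ceiling_def c m_def[symmetric] by (simp add: field_simps)
  finally show "dyadic_cell n x = {dyadic_floor n x<..<dyadic_ceiling n x}" by blast
  show "dyadic_floor n x < dyadic_ceiling n x"
    unfolding dyadic_floor_def dyadic_ceiling_def c m_def[symmetric] by (simp add: divide_strict_right_mono)
qed

lemma closure_dyadic_cell_subset: "closure (dyadic_cell n x) \<subseteq> {dyadic_floor n x..dyadic_ceiling n x}"
  by (cases "2 ^ n * x \<in> \<int>")
    (auto simp: dyadic_cell_Ints dyadic_cell_not_Ints dyadic_floor_le dyadic_ceiling_ge)

lemma convex_dyadic_cell: "convex (dyadic_cell n x)"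
  by (cases "2 ^ n * x \<in> \<int>") (simp_all add: dyadic_cell_Ints dyadic_cell_not_Ints)

text \<open>A cell is determined by its floor and ceiling, which range over finitely many integers
  when the points stay in a bounded interval.\<close>

lemma finite_dyadic_cells:
  shows "finite (dyadic_cell n ` {a..b})"
proof -
  let ?h = "\<lambda>(i, j). {t. \<lfloor>2 ^ n * t\<rfloor> = i \<and> \<lceil>2 ^ n * t\<rceil> = j}"
  let ?I = "{\<lfloor>2 ^ n * a\<rfloor>..\<lceil>2 ^ n * b\<rceil>}"
  have "dyadic_cell n ` {a..b} \<subseteq> ?h ` (?I \<times> ?I)"
  proof
    fix e assume "e \<in> dyadic_cell n ` {a..b}"
    then obtain x where x: "a \<le> x" "x \<le> b" "e = dyadic_cell n x" by auto
    have "2 ^ n * a \<le> 2 ^ n * x" "2 ^ n * x \<le> 2 ^ n * b" using x by auto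
    then have "\<lfloor>2 ^ n * x\<rfloor> \<in> ?I" "\<lceil>2 ^ n * x\<rceil> \<in> ?I" by (auto; linarith)+
    moreover have "e = ?h (\<lfloor>2 ^ n * x\<rfloor>, \<lceil>2 ^ n * x\<rceil>)" using x by (simp add: dyadic_cell_def)
    ultimately show "e \<in> ?h ` (?I \<times> ?I)" by blast
  qed
  then show ?thesis by (rule finite_subset) auto
qed

text \<open>Each factor is a point or an open interval, so this one formula produces the vertices,
  the edges and the open squares of the grid.\<close>

definition grid_cell :: "nat \<Rightarrow> real \<times> real \<Rightarrow> (real \<times> real) set" where
  "grid_cell n z = dyadic_cell n (fst z) \<times> dyadic_cell n (snd z)"

lemma grid_cell_self: "z \<in> grid_cell n z"
  by (simp add: grid_cell_def mem_Times_iff dyadic_cell_self)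

lemma grid_cell_eq: "w \<in> grid_cell n z \<Longrightarrow> grid_cell n w = grid_cell n z"
  by (auto simp: grid_cell_def mem_Times_iff dyadic_cell_eq)

lemma grid_cell_coarsen: "w \<in> grid_cell n z \<Longrightarrow> m \<le> n \<Longrightarrow> w \<in> grid_cell m z"
  by (auto simp: grid_cell_def mem_Times_iff dyadic_cell_coarsen)

lemma convex_grid_cell: "convex (grid_cell n z)"
  by (simp add: grid_cell_def convex_Times convex_dyadic_cell)

lemma finite_grid_cells:
  assumes "bounded S"
  shows "finite (grid_cell n ` S)"
proof -
  obtain r where r: "\<And>z. z \<in> S \<Longrightarrow> norm z \<le> r" using assms by (auto simp: bounded_iff)
  have "grid_cell n ` S \<subseteq> (\<lambda>(P, Q). P \<times> Q) ` (dyadic_cell n ` {-r..r} \<times> dyadic_cell n ` {-r..r})"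
  proof
    fix e assume "e \<in> grid_cell n ` S"
    then obtain z where z: "z \<in> S" "e = grid_cell n z" by blast
    have "\<bar>fst z\<bar> \<le> r" "\<bar>snd z\<bar> \<le> r"
      using r[OF z(1)] norm_fst_le[of "fst z" "snd z"] norm_snd_le[of "snd z" "fst z"] by auto
    then have "(dyadic_cell n (fst z), dyadic_cell n (snd z)) \<in> dyadic_cell n ` {-r..r} \<times> dyadic_cell n ` {-r..r}"
      by (auto simp: abs_le_iff intro!: imageI)
    then show "e \<in> (\<lambda>(P, Q). P \<times> Q) ` (dyadic_cell n ` {-r..r} \<times> dyadic_cell n ` {-r..r})"
      unfolding z(2) grid_cell_def by (intro image_eqI) auto
  qed
  then show ?thesis by (rule finite_subset) (auto intro!: finite_dyadic_cells)
qed

lemma semialgebraic_grid_cell: "semialgebraic (grid_cell n z)"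
proof -
  have "semialgebraic {w. fst w \<in> dyadic_cell n x}" for x
  proof (cases "2 ^ n * x \<in> \<int>")
    case False
    have "{w. fst w \<in> {a<..<b}} = {w. fst w > a} \<inter> {w. fst w < b}" for a b :: real by auto
    then show ?thesis
      unfolding dyadic_cell_not_Ints(1)[OF False] by (metis sa_int semialgebraic_halfplanes(2,3))
  qed (simp add: dyadic_cell_Ints semialgebraic_halfplanes)
  moreover have "semialgebraic {w. snd w \<in> dyadic_cell n x}" for x
  proof (cases "2 ^ n * x \<in> \<int>")
    case False
    have "{w. snd w \<in> {a<..<b}} = {w. snd w > a} \<inter> {w. snd w < b}" for a b :: real by auto
    then show ?thesis
      unfolding dyadic_cell_not_Ints(1)[OF False] by (metis sa_int semialgebraic_halfplanes(5,6))
  qed (simp add: dyadic_cell_Ints semialgebraic_halfplanes)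
  moreover have "grid_cell n z = {w. fst w \<in> dyadic_cell n (fst z)} \<inter> {w. snd w \<in> dyadic_cell n (snd z)}"
    by (auto simp: grid_cell_def)
  ultimately show ?thesis by (metis sa_int)
qed

section \<open>Grid cells as cells of dimension 0, 1 and 2\<close>

lemma cell1_open_segment:
  assumes "p \<noteq> q"
  shows "cell1 (open_segment p q)"
proof -
  obtain f :: "real \<Rightarrow> real \<times> real" and g where "homeomorphism {-1<..<1} (open_segment p q) f g"
    by (rule segment_characteristic_map[OF assms]) (rule that)
  then have "open_segment p q homeomorphic {-1<..<1::real}"
    using homeomorphic_def homeomorphic_sym by blast
  moreover have "{-1<..<1::real} homeomorphic {0<..<1::real}"
    using homeomorphic_open_interval_UNIV[of "-1" 1] homeomorphic_open_interval_UNIV[of 0 1]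
    by (meson homeomorphic_sym homeomorphic_trans neg_less_0_iff_less less_trans zero_less_one)
  ultimately show ?thesis unfolding cell1_def using homeomorphic_trans by blast
qed

lemma cell2_interior:
  assumes "convex S" "compact S" "interior S \<noteq> {}"
  shows "cell2 (interior S)"
  using convex_body_characteristic_map[OF assms] unfolding cell2_def
  by (metis homeomorphic_def homeomorphic_sym)

lemma open_segment_horizontal: "a < b \<Longrightarrow> {a<..<b} \<times> {y} = open_segment (a, y) (b, y)"
  and open_segment_vertical: "a < b \<Longrightarrow> {y} \<times> {a<..<b} = open_segment (y, a) (y, b)" for a b y :: real
proof -
  assume ab: "a < b"
  then have *: "{a<..<b} = (\<lambda>u. (1 - u) *\<^sub>R a + u *\<^sub>R b) ` {0<..<1}"
    using open_segment_image_interval[of a b] by (simp add: open_segment_eq_real_ivl)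
  have **: "(1 - u) * y + u * y = y" for u by (simp add: algebra_simps)
  show "{a<..<b} \<times> {y} = open_segment (a, y) (b, y)" "{y} \<times> {a<..<b} = open_segment (y, a) (y, b)"
    unfolding * using ab by (auto simp: open_segment_image_interval image_iff **)
qed

lemma cell0_grid_cell:
  assumes "2 ^ n * fst z \<in> \<int>" "2 ^ n * snd z \<in> \<int>"
  shows "cell0 (grid_cell n z)"
  using assms by (auto simp: grid_cell_def cell0_def dyadic_cell_Ints)

text \<open>The hypothesis encodes that exactly one coordinate of \<open>z\<close> lies on the grid.
  The end points are recorded as grid vertices so that they can later be recognized as
  0-cells.\<close>

lemma grid_cell_edge:
  assumes "2 ^ n * fst z \<in> \<int> \<longleftrightarrow> 2 ^ n * snd z \<notin> \<int>"
  obtains p q where "p \<noteq> q" "grid_cell n z = open_segment p q"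
    "\<And>u. u \<in> {p, q} \<Longrightarrow> 2 ^ n * fst u \<in> \<int> \<and> 2 ^ n * snd u \<in> \<int>"
proof (cases "2 ^ n * fst z \<in> \<int>")
  case True
  with assms have F: "2 ^ n * snd z \<notin> \<int>" by simp
  show ?thesis
  proof (rule that)
    show "grid_cell n z = open_segment (fst z, dyadic_floor n (snd z)) (fst z, dyadic_ceiling n (snd z))"
      by (simp add: grid_cell_def dyadic_cell_Ints[OF True] dyadic_cell_not_Ints[OF F] open_segment_vertical)
  qed (use True dyadic_cell_not_Ints(2)[OF F] dyadic_endpoints_Ints in auto)
next
  case False
  with assms have T: "2 ^ n * snd z \<in> \<int>" by simp
  show ?thesis
  proof (rule that)
    show "grid_cell n z = open_segment (dyadic_floor n (fst z), snd z) (dyadic_ceiling n (fst z), snd z)"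
      by (simp add: grid_cell_def dyadic_cell_Ints[OF T] dyadic_cell_not_Ints[OF False] open_segment_horizontal)
  qed (use T dyadic_cell_not_Ints(2)[OF False] dyadic_endpoints_Ints in auto)
qed

lemma grid_cell_square:
  assumes "2 ^ n * fst z \<notin> \<int>" "2 ^ n * snd z \<notin> \<int>"
  obtains S where "convex S" "compact S" "interior S = grid_cell n z" "S = closure (grid_cell n z)"
    "\<And>u. u \<in> S - interior S \<Longrightarrow> 2 ^ n * fst u \<in> \<int> \<or> 2 ^ n * snd u \<in> \<int>"
proof (rule that)
  let ?a = "dyadic_floor n (fst z)" and ?b = "dyadic_ceiling n (fst z)"
    and ?c = "dyadic_floor n (snd z)" and ?d = "dyadic_ceiling n (snd z)"
  define S where "S = {?a..?b} \<times> {?c..?d}"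
  have less: "?a < ?b" "?c < ?d" using assms dyadic_cell_not_Ints(2) by auto
  have cell: "grid_cell n z = {?a<..<?b} \<times> {?c<..<?d}"
    by (simp add: grid_cell_def dyadic_cell_not_Ints(1) assms)
  show "convex S" "compact S" by (auto simp: S_def convex_Times compact_Times)
  show int: "interior S = grid_cell n z"
    by (simp add: S_def interior_Times cell)
  show "S = closure (grid_cell n z)"
    by (simp add: S_def closure_Times cell less)
  show "2 ^ n * fst u \<in> \<int> \<or> 2 ^ n * snd u \<in> \<int>" if "u \<in> S - interior S" for u
  proof -
    have "fst u \<in> {?a, ?b} \<or> snd u \<in> {?c, ?d}"
      using that unfolding int cell unfolding S_def by (auto simp: mem_Times_iff)
    then show ?thesis using dyadic_endpoints_Ints by auto
  qed
qed

lemma cell1_grid_cell: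
  assumes "2 ^ n * fst z \<in> \<int> \<longleftrightarrow> 2 ^ n * snd z \<notin> \<int>"
  shows "cell1 (grid_cell n z)"
  using grid_cell_edge[OF assms] cell1_open_segment by metis

lemma cell2_grid_cell:
  assumes "2 ^ n * fst z \<notin> \<int>" "2 ^ n * snd z \<notin> \<int>"
  shows "cell2 (grid_cell n z)"
  using grid_cell_square[OF assms] cell2_interior grid_cell_self by (metis empty_iff)

subsection \<open>Cell complexes from grid exhaustions\<close>

text \<open>\<open>grid_cell_V\<close> makes \<open>V n\<close> a union of cells of its own mesh,
  and boundedness makes these finitely many. \<open>closure_grid_cell_V\<close> implies that the
  sets increase and confines the closure of a cell to the next stage, which yields
  closure-finiteness.\<close>

locale grid_exhaustion =
  fixes V :: "nat \<Rightarrow> (real \<times> real) set"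
  assumes open_V: "open (V n)"
    and bounded_V: "bounded (V n)"
    and grid_cell_V: "z \<in> V n \<Longrightarrow> grid_cell n z \<subseteq> V n"
    and closure_grid_cell_V: "z \<in> V n \<Longrightarrow> closure (grid_cell n z) \<subseteq> V (Suc n)"
begin

definition region :: "(real \<times> real) set" where
  "region = (\<Union>n. V n)"

definition level :: "real \<times> real \<Rightarrow> nat" where
  "level z = (LEAST n. z \<in> V n)"

definition cell :: "real \<times> real \<Rightarrow> (real \<times> real) set" where
  "cell z = grid_cell (level z) z"

definition cells :: "(real \<times> real) set set" where
  "cells = cell ` region"

lemma level_mem: "z \<in> region \<Longrightarrow> z \<in> V (level z)"
  unfolding region_def level_def by (auto intro: LeastI)

lemma level_le: "z \<in> V n \<Longrightarrow> level z \<le> n"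
  unfolding level_def by (rule Least_le)

lemma not_mem_below_level: "n < level z \<Longrightarrow> z \<notin> V n"
  using level_le not_less by blast

lemma cell_self: "z \<in> cell z"
  by (simp add: cell_def grid_cell_self)

lemma cell_subset_V: "z \<in> region \<Longrightarrow> cell z \<subseteq> V (level z)"
  by (simp add: cell_def grid_cell_V level_mem)

lemma closure_cell_subset_V: "z \<in> region \<Longrightarrow> closure (cell z) \<subseteq> V (Suc (level z))"
  by (simp add: cell_def closure_grid_cell_V level_mem)

lemma V_subset_region: "V n \<subseteq> region"
  by (auto simp: region_def)

lemma cell_subset_region: "z \<in> region \<Longrightarrow> cell z \<subseteq> region"
  using cell_subset_V V_subset_region by blast

lemma closure_cell_subset_region: "z \<in> region \<Longrightarrow> closure (cell z) \<subseteq> region"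
  using closure_cell_subset_V V_subset_region by blast

text \<open>If the cell of \<open>z\<close> met \<open>V n\<close> in \<open>w\<close>, the coarser
  cell of \<open>w\<close> at mesh \<open>n\<close> would contain \<open>z\<close>; since
  \<open>V n\<close> is a union of such cells, \<open>z\<close> would already have appeared by stage
  \<open>n\<close>.\<close>

lemma cell_disjoint_V:
  assumes "n < level z"
  shows "cell z \<inter> V n = {}"
proof (rule ccontr)
  assume "cell z \<inter> V n \<noteq> {}"
  then obtain w where w: "w \<in> grid_cell (level z) z" "w \<in> V n" by (auto simp: cell_def)
  have "w \<in> grid_cell n z" using grid_cell_coarsen[OF w(1)] assms by simp
  then have "z \<in> grid_cell n w" by (metis grid_cell_eq grid_cell_self)
  then show False using grid_cell_V[OF w(2)] not_mem_below_level[OF assms] by blast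
qed

text \<open>All points of a cell use the same mesh; this is what turns cells of different sizes into
  a partition.\<close>

lemma level_cell:
  assumes "z \<in> region" "w \<in> cell z"
  shows "level w = level z"
proof (rule antisym)
  show "level w \<le> level z"
    using assms cell_subset_V level_le by blast
  show "level z \<le> level w"
    using assms cell_disjoint_V[of "level w" z] level_mem[of w] cell_subset_region[of z]
    by (meson disjoint_iff not_less subsetD)
qed

lemma cell_eq:
  assumes "z \<in> region" "w \<in> cell z"
  shows "cell w = cell z"
  using assms level_cell[OF assms] by (simp add: cell_def grid_cell_eq)

text \<open>A cell is disjoint from the open sets \<open>V n\<close> below its level, and so is its
  closure. Thus the boundary of a cell meets only cells of the same or a finer grid.\<close>

lemma level_closure_cell:
  assumes "z \<in> region" "w \<in> closure (cell z)"
  shows "level z \<le> level w"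
proof (rule ccontr)
  assume "\<not> level z \<le> level w"
  then have "cell z \<inter> V (level w) = {}" by (simp add: cell_disjoint_V)
  then have "V (level w) \<inter> closure (cell z) = {}"
    using open_Int_closure_eq_empty[OF open_V, of "level w" "cell z"] by blast
  moreover have "w \<in> V (level w)"
    using assms closure_cell_subset_region by (blast intro: level_mem)
  ultimately show False using assms(2) by blast
qed

text \<open>Such cells have level at most \<open>n\<close> and so belong to finitely many grids
  restricted to bounded sets. Countability, closure-finiteness and the weak topology all rest on
  this.\<close>

lemma finite_cells_meeting_V: "finite {e \<in> cells. e \<inter> V n \<noteq> {}}"
proof (rule finite_subset)
  show "{e \<in> cells. e \<inter> V n \<noteq> {}} \<subseteq> (\<Union>m\<le>n. grid_cell m ` V m)"
  proof
    fix e assume "e \<in> {e \<in> cells. e \<inter> V n \<noteq> {}}"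
    then obtain z w where z: "z \<in> region" "e = cell z" and w: "w \<in> cell z" "w \<in> V n"
      by (auto simp: cells_def)
    have "level z \<le> n" using level_cell[OF z(1) w(1)] level_le[OF w(2)] by simp
    moreover have "e \<in> grid_cell (level z) ` V (level z)"
      using z by (simp add: cell_def level_mem)
    ultimately show "e \<in> (\<Union>m\<le>n. grid_cell m ` V m)" by blast
  qed
  show "finite (\<Union>m\<le>n. grid_cell m ` V m)"
    by (simp add: finite_grid_cells bounded_V)
qed

lemma countable_cells: "countable cells"
proof (rule countable_subset)
  show "cells \<subseteq> (\<Union>n. {e \<in> cells. e \<inter> V n \<noteq> {}})"
  proof
    fix e assume e: "e \<in> cells"
    then obtain z where z: "z \<in> region" "e = cell z" by (auto simp: cells_def)
    then have "z \<in> e \<inter> V (level z)" by (simp add: cell_self level_mem)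
    then show "e \<in> (\<Union>n. {e \<in> cells. e \<inter> V n \<noteq> {}})" using e by blast
  qed
  show "countable (\<Union>n. {e \<in> cells. e \<inter> V n \<noteq> {}})"
    by (rule countable_UN) (auto intro: countable_finite finite_cells_meeting_V)
qed

lemma cell_cases:
  obtains (vertex) "2 ^ level z * fst z \<in> \<int>" "2 ^ level z * snd z \<in> \<int>" "cell0 (cell z)"
    | (edge) "2 ^ level z * fst z \<in> \<int> \<longleftrightarrow> 2 ^ level z * snd z \<notin> \<int>" "cell1 (cell z)"
    | (square) "2 ^ level z * fst z \<notin> \<int>" "2 ^ level z * snd z \<notin> \<int>" "cell2 (cell z)"
  unfolding cell_def using cell0_grid_cell cell1_grid_cell cell2_grid_cell by metis

lemma cell_decomposition_cells: "cell_decomposition cells region"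
  unfolding cell_decomposition_def
proof (intro conjI ballI impI)
  show "countable cells" by (rule countable_cells)
  show "\<Union>cells = region" unfolding cells_def using cell_self cell_subset_region by blast
  show "{} \<notin> cells" unfolding cells_def using cell_self by blast
  fix e assume "e \<in> cells"
  then obtain z where z: "z \<in> region" "e = cell z" by (auto simp: cells_def)
  show "semialgebraic e" by (simp add: z cell_def semialgebraic_grid_cell)
  show "cell0 e \<or> cell1 e \<or> cell2 e" using cell_cases[of z] z by metis
  fix e' assume "e' \<in> cells" and ne: "e \<noteq> e'"
  then obtain z' where "z' \<in> region" "e' = cell z'" by (auto simp: cells_def)
  then have "e = e'" if "u \<in> e" "u \<in> e'" for u
    using that z cell_eq by metis
  then show "e \<inter> e' = {}" using ne by blast
qed

text \<open>A coordinate on the grid of \<open>z\<close> is also on the finer grid used at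
  \<open>u\<close>. Hence refinement can turn a boundary point into a point of a smaller edge or a
  vertex, but never put it into an open square.\<close>

lemma boundary_dyadic:
  assumes z: "z \<in> region" and u: "u \<in> closure (cell z)"
  shows "2 ^ level z * fst u \<in> \<int> \<Longrightarrow> 2 ^ level z * snd u \<in> \<int> \<Longrightarrow> u \<in> \<Union>{e\<in>cells. cell0 e}"
    and "2 ^ level z * fst u \<in> \<int> \<or> 2 ^ level z * snd u \<in> \<int> \<Longrightarrow> u \<in> \<Union>{e\<in>cells. cell0 e \<or> cell1 e}"
proof -
  have le: "level z \<le> level u" using level_closure_cell[OF z u] .
  have "cell u \<in> cells" using closure_cell_subset_region[OF z] u by (auto simp: cells_def)
  note mem = this cell_self[of u]
  show "u \<in> \<Union>{e\<in>cells. cell0 e}" if "2 ^ level z * fst u \<in> \<int>" "2 ^ level z * snd u \<in> \<int>"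
    using that[THEN dyadic_Ints_mono[OF _ le]] mem by (cases rule: cell_cases[of u]) auto
  show "u \<in> \<Union>{e\<in>cells. cell0 e \<or> cell1 e}" if "2 ^ level z * fst u \<in> \<int> \<or> 2 ^ level z * snd u \<in> \<int>"
    using that dyadic_Ints_mono[OF _ le] mem by (cases rule: cell_cases[of u]) auto
qed

lemma edge_characteristic_map:
  assumes z: "z \<in> region" and c: "cell1 (cell z)"
  shows "\<exists>\<Phi> :: real \<Rightarrow> real \<times> real.
           continuous_on {-1..1} \<Phi> \<and> \<Phi> ` {-1..1} \<subseteq> region \<and>
           (\<exists>\<psi>. homeomorphism {-1<..<1} (cell z) \<Phi> \<psi>) \<and>
           \<Phi> ` {-1, 1} \<subseteq> \<Union>{e'\<in>cells. cell0 e'}"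
proof -
  \<comment> \<open>Of the three kinds of grid cell, only an edge is compatible with the topological
    assumption \<open>cell1\<close>.\<close>
  have "2 ^ level z * fst z \<in> \<int> \<longleftrightarrow> 2 ^ level z * snd z \<notin> \<int>"
    using c cell_dimension_unique by (cases rule: cell_cases[of z]) auto
  then obtain p q where pq: "p \<noteq> q" "cell z = open_segment p q"
    "\<And>u. u \<in> {p, q} \<Longrightarrow> 2 ^ level z * fst u \<in> \<int> \<and> 2 ^ level z * snd u \<in> \<int>"
    unfolding cell_def using grid_cell_edge by metis
  obtain f :: "real \<Rightarrow> real \<times> real" and g where fg: "continuous_on {-1..1} f" "f ` {-1..1} = closed_segment p q"
    "homeomorphism {-1<..<1} (open_segment p q) f g" "f ` {-1, 1} = {p, q}"
    by (rule segment_characteristic_map[OF pq(1)]) (rule that)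
  have cl: "closure (cell z) = closed_segment p q" using pq by simp
  have "{p, q} \<subseteq> \<Union>{e'\<in>cells. cell0 e'}"
  proof
    fix u assume u: "u \<in> {p, q}"
    then show "u \<in> \<Union>{e'\<in>cells. cell0 e'}"
      using pq(3)[OF u] cl by (intro boundary_dyadic(1)[OF z]) auto
  qed
  then show ?thesis
    using fg closure_cell_subset_region[OF z] unfolding cl unfolding pq(2)
    by (intro exI[of _ f] conjI exI[of _ g]) simp_all
qed

lemma square_characteristic_map:
  assumes z: "z \<in> region" and c: "cell2 (cell z)"
  shows "\<exists>\<Phi> :: real \<times> real \<Rightarrow> real \<times> real.
           continuous_on (cball 0 1) \<Phi> \<and> \<Phi> ` cball 0 1 \<subseteq> region \<and>
           (\<exists>\<psi>. homeomorphism (ball 0 1) (cell z) \<Phi> \<psi>) \<and>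
           \<Phi> ` sphere 0 1 \<subseteq> \<Union>{e'\<in>cells. cell0 e' \<or> cell1 e'}"
proof -
  have "2 ^ level z * fst z \<notin> \<int>" "2 ^ level z * snd z \<notin> \<int>"
    using c cell_dimension_unique by (cases rule: cell_cases[of z]; auto)+
  then obtain S where S: "convex S" "compact S" "interior S = cell z" "S = closure (cell z)"
    "\<And>u. u \<in> S - interior S \<Longrightarrow> 2 ^ level z * fst u \<in> \<int> \<or> 2 ^ level z * snd u \<in> \<int>"
    using grid_cell_square[of "level z" z] unfolding cell_def by metis
  have ne: "interior S \<noteq> {}" using S(3) cell_self[of z] by auto
  obtain f g :: "real \<times> real \<Rightarrow> real \<times> real" where fg: "homeomorphism (cball 0 1) S f g"
    "homeomorphism (ball 0 1) (interior S) f g" "f ` sphere 0 1 = S - interior S"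
    by (rule convex_body_characteristic_map[OF S(1,2) ne]) (rule that)
  have "S - interior S \<subseteq> \<Union>{e'\<in>cells. cell0 e' \<or> cell1 e'}"
  proof
    fix u assume u: "u \<in> S - interior S"
    then show "u \<in> \<Union>{e'\<in>cells. cell0 e' \<or> cell1 e'}"
      using S(4,5) by (intro boundary_dyadic(2)[OF z]) auto
  qed
  moreover have "S \<subseteq> region" using closure_cell_subset_region[OF z] S(4) by simp
  moreover have "continuous_on (cball 0 1) f" "f ` cball 0 1 = S"
    using fg(1) by (auto simp: homeomorphism_def)
  ultimately show ?thesis
    using fg(2,3) S(3) by (intro exI[of _ f] conjI exI[of _ g]) auto
qed

text \<open>This is local finiteness: \<open>V (level u)\<close> is a neighbourhood of
  \<open>u\<close> that meets only finitely many cells, so a limit point \<open>u\<close> of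
  \<open>S\<close> is a limit point of the part of \<open>S\<close> in one closed cell, where
  closedness is assumed.\<close>

lemma closedin_weak_topology:
  assumes S: "S \<subseteq> region"
    and closed: "\<And>e. e \<in> cells \<Longrightarrow>
      closedin (top_of_set (closure_in_sp region e)) (S \<inter> closure_in_sp region e)"
  shows "closedin (top_of_set region) S"
proof -
  have "u \<in> S" if u: "u \<in> region" "u \<in> closure S" for u
  proof -
    define N where "N = V (level u)"
    define F where "F = {e \<in> cells. e \<inter> N \<noteq> {}}"
    define T where "T e = S \<inter> closure_in_sp region e" for e
    have "finite F" by (simp add: F_def N_def finite_cells_meeting_V)
    have "N \<inter> S \<subseteq> (\<Union>e\<in>F. T e)"
    proof
      fix w assume w: "w \<in> N \<inter> S"
      then have "cell w \<in> F" "w \<in> T (cell w)"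
        using S cell_self[of w] closure_subset[of "cell w"]
        by (auto simp: F_def T_def cells_def closure_in_sp_def)
      then show "w \<in> (\<Union>e\<in>F. T e)" by blast
    qed
    moreover have "u \<in> closure (N \<inter> S)"
      using u level_mem[OF u(1)] open_Int_closure_subset[OF open_V] unfolding N_def by blast
    \<comment> \<open>Finiteness of \<open>F\<close> enters here: a finite union of closures is
      closed.\<close>
    moreover have "closure (\<Union>e\<in>F. T e) \<subseteq> (\<Union>e\<in>F. closure (T e))"
      using \<open>finite F\<close> closure_subset by (intro closure_minimal closed_UN UN_mono) auto
    ultimately obtain e where e: "e \<in> F" "u \<in> closure (T e)"
      using closure_mono by blast
    have "T e \<subseteq> closure e" by (auto simp: T_def closure_in_sp_def)
    then have "u \<in> closure_in_sp region e"
      using e(2) u(1) closure_minimal[of "T e" "closure e"] by (auto simp: closure_in_sp_def)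
    moreover have "closedin (top_of_set (closure_in_sp region e)) (T e)"
      using closed e(1) by (simp add: T_def F_def)
    then obtain C where C: "closed C" "T e = closure_in_sp region e \<inter> C"
      by (auto simp: closedin_closed)
    moreover have "u \<in> C"
      using e(2) C closure_minimal[of "T e" C] by blast
    ultimately have "u \<in> T e" by blast
    then show ?thesis by (simp add: T_def)
  qed
  then have "S = region \<inter> closure S" using S closure_subset by blast
  then show ?thesis by (metis closed_closure closedin_closed_Int)
qed

section \<open>The CW structure and the finiteness property of the cells\<close>

lemma CW_complex_cells: "CW_complex region cells"
  unfolding CW_complex_def
proof (intro conjI ballI allI impI iffI)
  show "cell_decomposition cells region" by (rule cell_decomposition_cells)
next
  fix e assume "e \<in> cells" and e: "cell1 e"
  then obtain z where z: "z \<in> region" "e = cell z" by (auto simp: cells_def)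
  from e show "\<exists>\<Phi> :: real \<Rightarrow> real \<times> real.
           continuous_on {-1..1} \<Phi> \<and> \<Phi> ` {-1..1} \<subseteq> region \<and>
           (\<exists>\<psi>. homeomorphism {-1<..<1} e \<Phi> \<psi>) \<and>
           \<Phi> ` {-1, 1} \<subseteq> \<Union>{e'\<in>cells. cell0 e'}"
    unfolding z(2) using edge_characteristic_map[OF z(1)] by blast
next
  fix e assume "e \<in> cells" and e: "cell2 e"
  then obtain z where z: "z \<in> region" "e = cell z" by (auto simp: cells_def)
  from e show "\<exists>\<Phi> :: real \<times> real \<Rightarrow> real \<times> real.
           continuous_on (cball 0 1) \<Phi> \<and> \<Phi> ` cball 0 1 \<subseteq> region \<and>
           (\<exists>\<psi>. homeomorphism (ball 0 1) e \<Phi> \<psi>) \<and>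
           \<Phi> ` sphere 0 1 \<subseteq> \<Union>{e'\<in>cells. cell0 e' \<or> cell1 e'}"
    unfolding z(2) using square_characteristic_map[OF z(1)] by blast
next
  fix e assume "e \<in> cells"
  then obtain z where z: "z \<in> region" "e = cell z" by (auto simp: cells_def)
  have "{e'\<in>cells. e' \<inter> closure_in_sp region e \<noteq> {}} \<subseteq> {e'\<in>cells. e' \<inter> V (Suc (level z)) \<noteq> {}}"
    using closure_cell_subset_V[OF z(1)] by (auto simp: z(2) closure_in_sp_def)
  then show "finite {e'\<in>cells. e' \<inter> closure_in_sp region e \<noteq> {}}"
    using finite_cells_meeting_V finite_subset by blast
next
  fix S e assume "S \<subseteq> region" "closedin (top_of_set region) S" "e \<in> cells"
  then show "closedin (top_of_set (closure_in_sp region e)) (S \<inter> closure_in_sp region e)"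
    by (auto simp: closedin_closed closure_in_sp_def)
next
  fix S assume "S \<subseteq> region"
    "\<forall>e\<in>cells. closedin (top_of_set (closure_in_sp region e)) (S \<inter> closure_in_sp region e)"
  then show "closedin (top_of_set region) S" by (intro closedin_weak_topology) auto
qed

lemma finiteness_property_cells: "finiteness_property region cells"
proof (rule convex_cells_finiteness_property)
  show "open region" by (auto simp: region_def open_V)
  show "convex e" if "e \<in> cells" for e
    using that by (auto simp: cells_def cell_def convex_grid_cell)
qed

end

subsection \<open>Dyadic decomposition of an open set\<close>

text \<open>
  The closed square cells around \<open>z\<close>, fattened by one mesh width: the margin is what makes the stars
  shrink when the grid is refined, even at the boundary of a cell.
\<close>

definition dyadic_star :: "nat \<Rightarrow> real \<times> real \<Rightarrow> (real \<times> real) set" where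
  "dyadic_star n z =
     {dyadic_ceiling n (fst z) - 2 / 2 ^ n..dyadic_floor n (fst z) + 2 / 2 ^ n} \<times>
     {dyadic_ceiling n (snd z) - 2 / 2 ^ n..dyadic_floor n (snd z) + 2 / 2 ^ n}"

lemma dyadic_ceiling_minus_le: "dyadic_ceiling n x - 2 / 2 ^ n \<le> x"
  and le_dyadic_floor_plus: "x \<le> dyadic_floor n x + 2 / 2 ^ n"
proof -
  have "(2::real) / 2 ^ n = 1 / 2 ^ n + 1 / 2 ^ n" "(0::real) \<le> 1 / 2 ^ n" by simp_all
  then show "dyadic_ceiling n x - 2 / 2 ^ n \<le> x" "x \<le> dyadic_floor n x + 2 / 2 ^ n"
    using less_dyadic_floor[of x n] dyadic_ceiling_less[of n x] by linarith+
qed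

lemma dyadic_star_self: "z \<in> dyadic_star n z"
  by (simp add: dyadic_star_def mem_Times_iff dyadic_ceiling_minus_le le_dyadic_floor_plus)

lemma dyadic_star_cell: "w \<in> grid_cell n z \<Longrightarrow> dyadic_star n w = dyadic_star n z"
  by (auto simp: dyadic_star_def grid_cell_def mem_Times_iff dyadic_cell_floor_ceiling)

text \<open>The reach beyond the grid value drops from \<open>2 / 2 ^ n\<close> to
  \<open>1 / 2 ^ n\<close>. The \<open>1 / 2 ^ n\<close> gained in this way covers the distance
  between floor and ceiling, within which a point of the closed cell can move.\<close>

lemma dyadic_star_refine:
  assumes "w \<in> closure (grid_cell n z)"
  shows "dyadic_star (Suc n) w \<subseteq> dyadic_star n z"
proof -
  have *: "dyadic_ceiling n x - 2 / 2 ^ n \<le> dyadic_ceiling (Suc n) t - 2 / 2 ^ Suc n"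
      "dyadic_floor (Suc n) t + 2 / 2 ^ Suc n \<le> dyadic_floor n x + 2 / 2 ^ n"
    if "t \<in> closure (dyadic_cell n x)" for t x
  proof -
    have "(2::real) / 2 ^ n = 1 / 2 ^ n + 1 / 2 ^ n" "(2::real) / 2 ^ Suc n = 1 / 2 ^ n" by simp_all
    moreover have "dyadic_floor n x \<le> t" "t \<le> dyadic_ceiling n x"
      using that closure_dyadic_cell_subset[of n x] by auto
    ultimately show "dyadic_ceiling n x - 2 / 2 ^ n \<le> dyadic_ceiling (Suc n) t - 2 / 2 ^ Suc n"
      "dyadic_floor (Suc n) t + 2 / 2 ^ Suc n \<le> dyadic_floor n x + 2 / 2 ^ n"
      using dyadic_ceiling_le_floor[of n x] dyadic_ceiling_ge[of t "Suc n"] dyadic_floor_le[of "Suc n" t]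
      by linarith+
  qed
  have "fst w \<in> closure (dyadic_cell n (fst z))" "snd w \<in> closure (dyadic_cell n (snd z))"
    using assms by (auto simp: grid_cell_def closure_Times)
  from this[THEN *(1)] this[THEN *(2)] show ?thesis
    unfolding dyadic_star_def by (intro Sigma_mono) auto
qed

text \<open>Near \<open>z\<close> ceilings only rise and floors only fall, so both ends of each side
  move inwards. This yields the openness of the exhausting sets.\<close>

lemma dyadic_star_semicontinuous:
  obtains U where "open U" "z \<in> U" "\<And>w. w \<in> U \<Longrightarrow> dyadic_star n w \<subseteq> dyadic_star n z"
proof
  define I where "I x = {dyadic_ceiling n x - 1 / 2 ^ n<..<dyadic_floor n x + 1 / 2 ^ n}" for x
  show "open (I (fst z) \<times> I (snd z))" by (simp add: I_def open_Times)
  show "z \<in> I (fst z) \<times> I (snd z)"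
    by (simp add: I_def mem_Times_iff less_dyadic_floor dyadic_ceiling_less)
  show "dyadic_star n w \<subseteq> dyadic_star n z" if "w \<in> I (fst z) \<times> I (snd z)" for w
    unfolding dyadic_star_def using that
    by (intro Sigma_mono) (auto simp: I_def dest!: dyadic_ceiling_mono_near dyadic_floor_mono_near)
qed

lemma dyadic_star_small:
  assumes "w \<in> dyadic_star n z"
  shows "dist w z \<le> 4 / 2 ^ n"
proof -
  have "dist t x \<le> 2 / 2 ^ n" if "t \<in> {dyadic_ceiling n x - 2 / 2 ^ n..dyadic_floor n x + 2 / 2 ^ n}" for t x
    using that dyadic_floor_le[of n x] dyadic_ceiling_ge[of x n] by (auto simp: dist_real_def)
  then have "dist (fst w) (fst z) \<le> 2 / 2 ^ n" "dist (snd w) (snd z) \<le> 2 / 2 ^ n"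
    using assms by (auto simp: dyadic_star_def mem_Times_iff)
  \<comment> \<open>The constant 4 comes from adding the bounds \<open>2 / 2 ^ n\<close> for the two
    coordinates.\<close>
  moreover have "dist w z \<le> dist (fst w) (fst z) + dist (snd w) (snd z)"
    by (simp add: dist_prod_def sqrt_sum_squares_le_sum)
  ultimately show ?thesis by simp
qed

section \<open>The exhaustion of an open set by stars\<close>

lemma open_has_cell_decomposition:
  assumes "open Y"
  shows "\<exists>A. cell_decomposition A Y \<and> CW_complex Y A \<and> finiteness_property Y A"
proof -
  \<comment> \<open>Stars in place of cells give openness by semicontinuity and the passage from
    closures to the next stage by refinement; the ball supplies boundedness and grows with
    \<open>n\<close> so that it does not obstruct that passage.\<close>
  define V where "V n = {z. dyadic_star n z \<subseteq> Y \<inter> cball 0 (real n)}" for n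
  interpret grid_exhaustion V
  proof
    fix n
    show "open (V n)"
    proof (subst open_subopen, intro ballI)
      fix z assume z: "z \<in> V n"
      obtain U where "open U" "z \<in> U" "\<And>w. w \<in> U \<Longrightarrow> dyadic_star n w \<subseteq> dyadic_star n z"
        using dyadic_star_semicontinuous[of z n] by metis
      then show "\<exists>T. open T \<and> z \<in> T \<and> T \<subseteq> V n"
        using z unfolding V_def by (intro exI[of _ U]) blast
    qed
    have "V n \<subseteq> cball 0 (real n)" using dyadic_star_self by (auto simp: V_def)
    then show "bounded (V n)" using bounded_cball bounded_subset by blast
    fix z assume z: "z \<in> V n"
    then show "grid_cell n z \<subseteq> V n" unfolding V_def using dyadic_star_cell by blast
    have "cball (0::real\<times>real) (real n) \<subseteq> cball 0 (real (Suc n))" by auto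
    then show "closure (grid_cell n z) \<subseteq> V (Suc n)"
      using z dyadic_star_refine unfolding V_def by blast
  qed
  have "region = Y"
  proof
    show "region \<subseteq> Y" unfolding region_def V_def using dyadic_star_self by blast
    show "Y \<subseteq> region"
    proof
      fix z assume "z \<in> Y"
      then obtain r where r: "r > 0" "cball z r \<subseteq> Y"
        using assms open_contains_cball by blast
      have "(\<lambda>n. 4 * (1 / 2) ^ n) \<longlonglongrightarrow> 4 * (0::real)"
        by (intro tendsto_intros LIMSEQ_realpow_zero) auto
      \<comment> \<open>\<open>4 * (1 / 2) ^ n\<close> bounds the distance from \<open>z\<close> to
        points of its star. Staying below \<open>r\<close> keeps the star in \<open>Y\<close>, and
        staying below 1 keeps it in the ball of radius \<open>norm z + 1\<close>, hence of radius
        \<open>n\<close> for large \<open>n\<close>.\<close>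
      then have "\<forall>\<^sub>F n in sequentially. 4 * (1 / 2) ^ n < min r 1"
        using r(1) by (intro order_tendstoD) auto
      moreover have "\<forall>\<^sub>F n in sequentially. norm z + 1 \<le> real n"
        using filterlim_real_sequentially by (simp add: filterlim_at_top)
      ultimately have "\<forall>\<^sub>F n in sequentially. 4 * (1 / 2) ^ n < min r 1 \<and> norm z + 1 \<le> real n"
        by eventually_elim auto
      then obtain n where n: "4 * (1 / 2 :: real) ^ n < min r 1" "norm z + 1 \<le> real n"
        using eventually_happens'[OF sequentially_bot] by blast
      have "w \<in> Y \<inter> cball 0 (real n)" if "w \<in> dyadic_star n z" for w
      proof -
        have "(4::real) / 2 ^ n = 4 * (1 / 2) ^ n" by (simp add: power_divide)
        then have "dist w z < min r 1" using dyadic_star_small[OF that] n(1) by linarith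
        then have "dist z w \<le> r" "dist w z \<le> 1" by (simp_all add: dist_commute)
        moreover have "norm w \<le> norm z + dist w z"
          by (metis add.commute dist_norm norm_triangle_sub)
        ultimately have "w \<in> cball z r" "norm w \<le> norm z + 1" by auto
        then show ?thesis using r(2) n(2) by (auto simp del: mem_cball intro: mem_cball_0[THEN iffD2])
      qed
      then have "z \<in> V n" unfolding V_def by blast
      then show "z \<in> region" using V_subset_region by blast
    qed
  qed
  then show ?thesis
    using cell_decomposition_cells CW_complex_cells finiteness_property_cells by metis
qed

theorem theorem3p4:
  fixes gs :: "real poly poly list"
  assumes "length gs \<ge> 1"
    and "distinct gs"
    and "\<forall>g\<in>set gs. g \<noteq> 0 \<and> irreducible g"
  shows "\<exists>A. cell_decomposition A {z. \<forall>g\<in>set gs. poly2 g z > 0}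
            \<and> CW_complex {z. \<forall>g\<in>set gs. poly2 g z > 0} A
            \<and> finiteness_property {z. \<forall>g\<in>set gs. poly2 g z > 0} A"
proof (rule open_has_cell_decomposition)
  have "open {z. poly2 g z > 0}" for g
    using open_Collect_less[OF continuous_on_const continuous_on_poly2] .
  then have "open (\<Inter>g\<in>set gs. {z. poly2 g z > 0})" by (intro open_INT) auto
  moreover have "(\<Inter>g\<in>set gs. {z. poly2 g z > 0}) = {z. \<forall>g\<in>set gs. poly2 g z > 0}" by auto
  ultimately show "open {z. \<forall>g\<in>set gs. poly2 g z > 0}" by simp
qed

end
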